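(* Let $m,n,r$ be positive integers, $L>0$, $\eta>0$, and let $\ell:\mathbb{R}^{m\times n}\to\mathbb{R}$ be differentiable with $L$-Lipschitz continuous gradient, i.e. $\|\nabla\ell(\mathbf{W})-\nabla\ell(\mathbf{W}')\|_{\mathrm F}\le L\|\mathbf{W}-\mathbf{W}'\|_{\mathrm F}$ for all $\mathbf{W},\mathbf{W}'\in\mathbb{R}^{m\times n}$. Let $(\mathbf{W}_t)_t$ be the sequence of weight matrices in $\mathbb{R}^{m\times n}$, and for each $t$ consider the singular value decomposition $\nabla\ell(\mathbf{W}_t)=\mathbf{U}_t\mathbf{\Sigma}_t\mathbf{V}_t^\top$, with singular values in non-increasing order. Suppose $\operatorname{rank}(\nabla\ell(\mathbf{W}_t))\ge 2r$ for all $t$. Then $(\tilde{\mathbf{A}}_t^*,\tilde{\mathbf{B}}_t^* )\in\mathbb{R}^{m\times r}\times\mathbb{R}^{n\times r}$ minimizes, over $(\tilde{\mathbf{A}}_t,\tilde{\mathbf{B}}_t)\in\mathbb{R}^{m\times r}\times\mathbb{R}^{n\times r}$, the objective $$\frac{L}{2}\Big\|\frac{1}{L}\nabla\ell(\mathbf{W}_t)-\eta\,\nabla\ell(\mathbf{W}_t)\tilde{\mathbf{B}}_t\tilde{\mathbf{B}}_t^\top-\eta\,\tilde{\mathbf{A}}_t\tilde{\mathbf{A}}_t^\top\nabla\ell(\mathbf{W}_t)\Big\|_{\mathrm F}^2$$ if and only if $$\tilde{\mathbf{A}}_t^*=\frac{1}{\sqrt{L\eta}}[\mathbf{U}_t]_{\mathcal{A}_t}\mathbf{P}_t,\qquad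 \tilde{\mathbf{B}}_t^*=\frac{1}{\sqrt{L\eta}}[\mathbf{V}_t]_{\mathcal{B}_t}\mathbf{Q}_t$$ for some index sets $\mathcal{A}_t,\mathcal{B}_t$ with $\mathcal{A}_t\cup\mathcal{B}_t=\{1,\ldots,2r\}$ and $|\mathcal{A}_t|=|\mathcal{B}_t|=r$, and some $\mathbf{P}_t,\mathbf{Q}_t\in\mathrm{O}(r)$.
   Context: $\|\cdot\|_{\mathrm F}$ is the Frobenius norm. $\mathrm{O}(r)$ is the group of $r\times r$ orthogonal matrices. For a matrix $\mathbf{M}$ and an index set $\mathcal{I}$, $[\mathbf{M}]_{\mathcal{I}}$ denotes the submatrix of $\mathbf{M}$ formed by the columns indexed by $\mathcal{I}$. Here $\ell$ is the loss function, $\mathbf{W}_t$ is the weight matrix at optimization step $t$, $\eta$ is the learning rate, and $r$ is the (small) rank of the low-rank adapters $\tilde{\mathbf{A}}_t,\tilde{\mathbf{B}}_t$.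
   Formalization: The singular value decomposition is not fixed beforehand: a pair is a minimizer iff it has the stated form for some singular value decomposition of the gradient; with a fixed one, "only if" fails when singular values repeat (e.g. gradient I, m=n=2, r=1). *)

theory Defs
  imports "HOL-Analysis.Analysis"
begin

(* An m x n matrix is an element of real^'n^'m with CARD('m) = m and CARD('n) = n.  The index
   types are of class {finite,wellorder}, so that rows and columns are ordered and the integers
   1, 2, ... can be used as row and column numbers. *)

text \<open>The norm of the type \<^typ>\<open>real^'n^'m\<close> is the Frobenius norm, and its inner product (the one
  that \<^const>\<open>gderiv\<close> refers to) is the Frobenius inner product.\<close>

lemma norm_matrix_Frobenius:
  fixes M :: "real^'n^'m"
  shows "norm M = sqrt (\<Sum>i\<in>UNIV. \<Sum>j\<in>UNIV. (M $ i $ j)\<^sup>2)"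
  by (simp add: norm_vec_def L2_set_def sum_nonneg)

lemma inner_matrix_Frobenius:
  fixes M N :: "real^'n^'m"
  shows "inner M N = (\<Sum>i\<in>UNIV. \<Sum>j\<in>UNIV. M $ i $ j * N $ i $ j)"
  by (simp add: inner_vec_def)

definition pos :: "'a::{finite,wellorder} \<Rightarrow> nat" where
  "pos i = card {..i}"

text \<open>The \<open>k\<close>-th smallest element of a finite set, counting from 1
  (\<^const>\<open>enumerate\<close> counts from 0).\<close>

definition kth :: "'a::wellorder set \<Rightarrow> nat \<Rightarrow> 'a" where
  "kth S k = enumerate S (k - 1)"

lemma pos_less:
  assumes "i < j"
  shows "pos i < pos j"
  unfolding pos_def using assms by (intro psubset_card_mono) auto

lemma bij_betw_pos: "bij_betw pos (UNIV :: 'a::{finite,wellorder} set) {1..CARD('a)}"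
proof -
  have inj: "inj (pos :: 'a \<Rightarrow> nat)"
    by (rule injI) (metis pos_less less_irrefl neq_iff)
  have "pos ` (UNIV :: 'a set) \<subseteq> {1..CARD('a)}"
    by (auto simp: pos_def Suc_le_eq card_gt_0_iff intro!: card_mono)
  then have "pos ` (UNIV :: 'a set) = {1..CARD('a)}"
    by (intro card_subset_eq) (simp_all add: card_image inj)
  with inj show ?thesis
    by (simp add: bij_betw_def)
qed

lemma pos_kth:
  assumes "k \<in> {1..CARD('a::{finite,wellorder})}"
  shows "pos (kth (UNIV :: 'a set) k) = k"
proof -
  have bij: "bij_betw (enumerate (UNIV :: 'a set)) {..<CARD('a)} UNIV"
    by (rule finite_bij_enumerate) simp
  have mono: "enumerate (UNIV :: 'a set) a < enumerate UNIV b \<longleftrightarrow> a < b"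
    if "a < CARD('a)" "b < CARD('a)" for a b
    using that by (intro finite_enumerate_mono_iff) auto
  have "{..kth (UNIV :: 'a set) k} = enumerate UNIV ` {..<k}"
  proof (intro set_eqI iffI)
    fix x :: 'a assume x: "x \<in> {..kth UNIV k}"
    obtain a where a: "a < CARD('a)" "x = enumerate UNIV a"
      using bij by (metis UNIV_I bij_betw_def imageE lessThan_iff)
    have "\<not> k - 1 < a"
      using x a assms mono[of "k - 1" a] by (auto simp: kth_def not_less[symmetric])
    then show "x \<in> enumerate UNIV ` {..<k}"
      using a assms by auto
  next
    fix x :: 'a assume "x \<in> enumerate UNIV ` {..<k}"
    then obtain a where a: "a < k" "x = enumerate UNIV a"
      by auto
    then show "x \<in> {..kth UNIV k}"
      using assms mono[of "k - 1" a] by (auto simp: kth_def not_less[symmetric])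
  qed
  moreover have "inj_on (enumerate (UNIV :: 'a set)) {..<k}"
    using bij assms by (auto simp: bij_betw_def intro: inj_on_subset)
  ultimately show ?thesis
    by (simp add: pos_def card_image)
qed

text \<open>\<open>cols M I\<close> is the submatrix \<open>[M]\<^sub>I\<close> of the columns of \<open>M\<close> with numbers in \<open>I\<close>, in increasing
  order; it is meaningful for \<open>I \<subseteq> {1..CARD('k)}\<close> with \<open>card I = CARD('r)\<close>.\<close>

definition cols ::
  "real^'k::{finite,wellorder}^'m \<Rightarrow> nat set \<Rightarrow> real^'r::{finite,wellorder}^'m" where
  "cols M I = (\<chi> i j. M $ i $ kth UNIV (kth I (pos j)))"

text \<open>Full singular value decomposition \<open>G = U S V\<^sup>T\<close>: the square matrices \<open>U\<close>, \<open>V\<close> are orthogonal,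
  and the rectangular matrix \<open>S\<close> is diagonal with nonnegative non-increasing diagonal entries.\<close>

definition is_svd ::
  "real^'n::{finite,wellorder}^'m::{finite,wellorder} \<Rightarrow>
     real^'m::_^'m::_ \<Rightarrow> real^'n::_^'m::_ \<Rightarrow> real^'n::_^'n::_ \<Rightarrow> bool"
  where
  "is_svd G U S V \<longleftrightarrow>
     orthogonal_matrix U \<and> orthogonal_matrix V \<and>
     (\<forall>i j. pos i \<noteq> pos j \<longrightarrow> S $ i $ j = 0) \<and>
     (\<forall>i j. pos i = pos j \<longrightarrow> 0 \<le> S $ i $ j) \<and>
     (\<forall>i j i' j'. pos i = pos j \<and> pos i' = pos j' \<and> pos i \<le> pos i' \<longrightarrow> S $ i' $ j' \<le> S $ i $ j) \<and>
     G = U ** S ** transpose V"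

definition adapter_objective ::
  "real \<Rightarrow> real \<Rightarrow> real^'n^'m \<Rightarrow> real^'r^'m \<Rightarrow> real^'r^'n \<Rightarrow> real" where
  "adapter_objective L \<eta> G A B =
     L / 2 * (norm ((1 / L) *\<^sub>R G - \<eta> *\<^sub>R (G ** B ** transpose B) - \<eta> *\<^sub>R (A ** transpose A ** G)))\<^sup>2"

end

theory Submission
  imports Defs
begin

text \<open>After rescaling, the objective is a multiple of \<open>\<parallel>D\<parallel>\<^sup>2\<close> with \<open>D = G - G B B\<^sup>T - A A\<^sup>T G\<close>. Choose a
  subspace \<open>R\<close> of dimension \<open>2r\<close> that contains the ranges of \<open>B\<close> and \<open>G\<^sup>T A\<close>. Off \<open>R\<close> the residual
  \<open>D\<close> agrees with \<open>G\<close>, so \<open>\<parallel>D\<parallel>\<^sup>2 \<ge> \<parallel>G\<parallel>\<^sup>2 - \<Sum> \<parallel>G e\<parallel>\<^sup>2\<close> over an orthonormal basis of \<open>R\<close>, and Ky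
  Fan's principle bounds the sum by that of the \<open>2r\<close> largest squared singular values.

  In the case of equality, \<open>D\<close> vanishes on \<open>R\<close>, and exchanging a unit vector of \<open>R\<close> against one of its
  orthogonal complement shows that \<open>G\<close> maps the two to orthogonal spaces and is larger on \<open>R\<close>. With
  \<open>Y = B B\<^sup>T\<close> the identity \<open>G (x - Y x) = A A\<^sup>T G x\<close> on \<open>R\<close> makes \<open>G\<^sup>T G\<close> and \<open>Y\<close> commute there, and
  as \<open>Y\<close> and \<open>1 - Y\<close> both have rank at most \<open>r\<close> on \<open>R\<close>, they are complementary projections. Bases of
  their ranges and of the complement of \<open>R\<close> that \<open>G\<close> maps to orthogonal vectors are
  the right singular vectors of the required decomposition.\<close>

subsection \<open>Orthonormal sets and Ky Fan's principle\<close>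

definition orthonormal :: "'a::euclidean_space set \<Rightarrow> bool" where
  "orthonormal E \<longleftrightarrow> pairwise orthogonal E \<and> (\<forall>x\<in>E. norm x = 1)"

lemma orthonormal_empty [simp]: "orthonormal {}"
  by (simp add: orthonormal_def)

lemma orthonormal_finite: "orthonormal E \<Longrightarrow> finite E"
  by (simp add: orthonormal_def pairwise_orthogonal_imp_finite)

lemma orthonormal_subset: "orthonormal E \<Longrightarrow> F \<subseteq> E \<Longrightarrow> orthonormal F"
  by (auto simp: orthonormal_def pairwise_def)

lemma orthonormal_inner:
  "orthonormal E \<Longrightarrow> x \<in> E \<Longrightarrow> y \<in> E \<Longrightarrow> x \<bullet> y = (if x = y then 1 else 0)"
  by (auto simp: orthonormal_def pairwise_def orthogonal_def norm_eq_1)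

lemma orthonormal_norm: "orthonormal E \<Longrightarrow> x \<in> E \<Longrightarrow> norm x = 1"
  by (simp add: orthonormal_def)

lemma orthonormal_independent: "orthonormal E \<Longrightarrow> independent E"
  by (rule pairwise_orthogonal_independent) (auto simp: orthonormal_def)

lemma orthonormal_card: "orthonormal E \<Longrightarrow> card E = dim (span E)"
  by (simp add: dim_eq_card_independent orthonormal_independent)

lemma orthonormal_span_UNIV:
  fixes E :: "'a::euclidean_space set"
  assumes "orthonormal E" "card E = DIM('a)"
  shows "span E = UNIV"
  using assms by (metis dim_eq_full orthonormal_card span_span)

lemma orthonormal_card_UNIV:
  fixes E :: "'a::euclidean_space set"
  assumes "orthonormal E" "span E = UNIV"
  shows "card E = DIM('a)"
  using assms by (metis dim_UNIV orthonormal_card)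

lemma orthonormal_Un:
  assumes "orthonormal E" "orthonormal F" "\<And>x y. x \<in> E \<Longrightarrow> y \<in> F \<Longrightarrow> x \<bullet> y = 0"
  shows "orthonormal (E \<union> F)" "E \<inter> F = {}"
proof -
  show "orthonormal (E \<union> F)"
    using assms unfolding orthonormal_def pairwise_def orthogonal_def
    by (metis Un_iff inner_commute)
  show "E \<inter> F = {}"
    using assms(1,3) by (force simp: orthonormal_def)
qed

lemma orthonormal_expand:
  "orthonormal E \<Longrightarrow> x \<in> span E \<Longrightarrow> (\<Sum>e\<in>E. (x \<bullet> e) *\<^sub>R e) = x"
  by (rule orthonormal_basis_expand) (auto simp: orthonormal_def pairwise_orthogonal_imp_finite)

text \<open>Pythagoras for images that need not be unit vectors: the identity map gives Parseval,
  and an orthonormal basis with orthogonal images gives the expansion of \<open>norm (f e)\<close>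
  behind \<open>ky_fan\<close>.\<close>

lemma norm_sq_sum_orthogonal:
  fixes f :: "'a \<Rightarrow> 'b::real_inner"
  assumes "finite E" "pairwise (\<lambda>x y. f x \<bullet> f y = 0) E"
  shows "(norm (\<Sum>e\<in>E. c e *\<^sub>R f e))\<^sup>2 = (\<Sum>e\<in>E. (c e)\<^sup>2 * (norm (f e))\<^sup>2)"
proof -
  have "(norm (\<Sum>e\<in>E. c e *\<^sub>R f e))\<^sup>2 = (\<Sum>x\<in>E. \<Sum>y\<in>E. c x * (c y * (f x \<bullet> f y)))"
    unfolding power2_norm_eq_inner
    by (subst inner_sum_left, intro sum.cong refl, subst inner_sum_right) (simp add: mult_ac)
  also have "\<dots> = (\<Sum>x\<in>E. \<Sum>y\<in>E. if y = x then (c x)\<^sup>2 * (norm (f x))\<^sup>2 else 0)"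
    using assms(2)
    by (intro sum.cong refl) (auto simp: pairwise_def dot_square_norm power2_eq_square)
  also have "\<dots> = (\<Sum>e\<in>E. (c e)\<^sup>2 * (norm (f e))\<^sup>2)"
    by (simp add: assms(1))
  finally show ?thesis .
qed

lemma orthonormal_parseval:
  assumes "orthonormal E" "x \<in> span E"
  shows "(\<Sum>e\<in>E. (x \<bullet> e)\<^sup>2) = (norm x)\<^sup>2"
proof -
  have "pairwise (\<lambda>x y. x \<bullet> y = 0) E"
    using assms(1) by (auto simp: orthonormal_def pairwise_def orthogonal_def)
  from norm_sq_sum_orthogonal[of E "\<lambda>e. e", OF orthonormal_finite[OF assms(1)] this, of "\<lambda>e. x \<bullet> e"]
  show ?thesis
    using assms by (simp add: orthonormal_expand orthonormal_norm)
qed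

lemma linear_expand:
  assumes "linear f" "orthonormal E" "x \<in> span E"
  shows "f x = (\<Sum>e\<in>E. (x \<bullet> e) *\<^sub>R f e)"
proof -
  have "f x = f (\<Sum>e\<in>E. (x \<bullet> e) *\<^sub>R e)"
    using assms by (simp add: orthonormal_expand)
  also have "\<dots> = (\<Sum>e\<in>E. (x \<bullet> e) *\<^sub>R f e)"
    using assms(1) by (simp add: linear_sum linear_scale)
  finally show ?thesis .
qed

text \<open>Induction step for building bases: a unit vector of \<open>T\<close> completes any
  orthonormal basis of its orthogonal slice in \<open>T\<close>.\<close>

lemma orthonormal_insert:
  assumes "subspace T" "v \<in> T" "norm v = 1" "orthonormal E" "span E = T \<inter> {w. v \<bullet> w = 0}"
  shows "orthonormal (insert v E)" "span (insert v E) = T" "v \<notin> E"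
proof -
  have E: "E \<subseteq> T" "\<And>w. w \<in> E \<Longrightarrow> v \<bullet> w = 0"
    using assms(5) span_superset[of E] by auto
  have "orthonormal ({v} \<union> E)"
    using assms(3,4) E(2) by (intro orthonormal_Un) (auto simp: orthonormal_def)
  then show "orthonormal (insert v E)" by simp
  show "v \<notin> E"
    using E(2)[of v] assms(3) by auto
  show "span (insert v E) = T"
  proof
    show "span (insert v E) \<subseteq> T"
      using assms(1,2) E(1) by (intro span_minimal) auto
    show "T \<subseteq> span (insert v E)"
    proof
      fix x assume "x \<in> T"
      \<comment> \<open>Removing the component of \<open>x\<close> along \<open>v\<close> leaves a
        vector of the slice.\<close>
      then have "x - (v \<bullet> x) *\<^sub>R v \<in> span E"
        using assms by (auto simp: inner_diff_right norm_eq_1 intro: subspace_diff subspace_scale)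
      then show "x \<in> span (insert v E)"
        by (auto simp: span_breakdown_eq)
    qed
  qed
qed

section \<open>First variation and orthonormal bases with orthogonal images\<close>

lemma subspace_orthogonal_slice: "subspace T \<Longrightarrow> subspace (T \<inter> {w. v \<bullet> w = 0})"
  by (intro subspace_inter subspace_hyperplane)

text \<open>Near \<open>t = 0\<close> the linear term dominates, and a suitable sign of
  \<open>t\<close> makes it positive. The choice \<open>t = a / d\<close> with
  \<open>b < 2 * d\<close> makes this quantitative.\<close>

lemma quadratic_no_linear_term:
  fixes a b :: real
  assumes "\<And>t. 2 * t * a \<le> t\<^sup>2 * b"
  shows "a = 0"
proof (rule ccontr)
  assume "a \<noteq> 0"
  define d where "d = \<bar>b\<bar> + 1"
  have d: "d > 0" "b < 2 * d" by (auto simp: d_def)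
  have "2 * (a / d) * a \<le> (a / d)\<^sup>2 * b" by (rule assms)
  then have "2 * a\<^sup>2 * d \<le> a\<^sup>2 * b"
    using d(1) by (simp add: field_simps power2_eq_square)
  then have "2 * d \<le> b"
    using \<open>a \<noteq> 0\<close> by (simp add: mult.assoc mult.left_commute[of 2])
  with d show False by simp
qed

text \<open>Expanding both sides along \<open>v + t w\<close> cancels the constant terms; the right
  side has no linear term because \<open>w\<close> is orthogonal to \<open>v\<close>, so the linear
  term on the left must vanish.\<close>

lemma first_order_optimality:
  fixes f :: "'a::euclidean_space \<Rightarrow> 'b::real_inner"
  assumes "linear f" "norm v = 1" "v \<bullet> w = 0"
    and "\<And>t. (norm (f (v + t *\<^sub>R w)))\<^sup>2 \<le> (norm (f v))\<^sup>2 * (norm (v + t *\<^sub>R w))\<^sup>2"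
  shows "f v \<bullet> f w = 0"
proof (rule quadratic_no_linear_term)
  fix t :: real
  have f: "f (v + t *\<^sub>R w) = f v + t *\<^sub>R f w"
    using assms(1) by (simp add: linear_add linear_scale)
  have n: "(norm (v + t *\<^sub>R w))\<^sup>2 = 1 + t\<^sup>2 * (norm w)\<^sup>2"
    using assms(2,3) unfolding power2_norm_eq_inner
    by (simp add: inner_add_left inner_add_right norm_eq_1 inner_commute[of w v] power2_eq_square)
  have "(norm (f (v + t *\<^sub>R w)))\<^sup>2 = (norm (f v))\<^sup>2 + 2 * t * (f v \<bullet> f w) + t\<^sup>2 * (norm (f w))\<^sup>2"
    unfolding f power2_norm_eq_inner
    by (simp add: inner_add_left inner_add_right inner_commute[of "f w" "f v"]
        power2_eq_square algebra_simps)
  with assms(4)[of t] n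
  show "2 * t * (f v \<bullet> f w) \<le> t\<^sup>2 * ((norm (f v))\<^sup>2 * (norm w)\<^sup>2 - (norm (f w))\<^sup>2)"
    by (simp add: algebra_simps)
qed

text \<open>Right singular vectors of \<open>f\<close> on \<open>T\<close>, obtained variationally:
  a unit vector maximizing \<open>norm (f x)\<close> has image orthogonal to the images of its
  slice, and the induction continues in that slice.\<close>

lemma ex_orthonormal_diagonal:
  fixes f :: "'a::euclidean_space \<Rightarrow> 'b::real_inner"
  assumes "linear f" "subspace T"
  shows "\<exists>E. orthonormal E \<and> span E = T \<and> pairwise (\<lambda>x y. f x \<bullet> f y = 0) E"
  using assms(2)
proof (induction "dim T" arbitrary: T rule: less_induct)
  case less
  show ?case
  proof (cases "T = {0}")
    case True
    then show ?thesis by (intro exI[of _ "{}"]) auto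
  next
    case False
    define K where "K = T \<inter> sphere 0 1"
    have "compact K"
      unfolding K_def using closed_subspace[OF less.prems]
      by (intro closed_Int_compact) auto
    moreover have "K \<noteq> {}"
    proof -
      obtain x where "x \<in> T" "x \<noteq> 0"
        using False less.prems subspace_0 by blast
      then have "x /\<^sub>R norm x \<in> K"
        using less.prems by (simp add: K_def subspace_scale)
      then show ?thesis by blast
    qed
    moreover have "continuous_on K (\<lambda>x. norm (f x))"
      using assms(1) by (intro continuous_intros linear_continuous_on linear_conv_bounded_linear[THEN iffD1])
    ultimately obtain v where v: "v \<in> K" and max: "\<And>x. x \<in> K \<Longrightarrow> norm (f x) \<le> norm (f v)"
      using continuous_attains_sup[of K "\<lambda>x. norm (f x)"] by blast
    have vT: "v \<in> T" "norm v = 1"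
      using v by (auto simp: K_def)
    \<comment> \<open>Homogeneity extends the maximum from the unit sphere of \<open>T\<close> to
      all of \<open>T\<close>, which covers the perturbations of \<open>v\<close>.\<close>
    have bound: "(norm (f x))\<^sup>2 \<le> (norm (f v))\<^sup>2 * (norm x)\<^sup>2" if "x \<in> T" for x
    proof (cases "x = 0")
      case False
      then have "norm (f (x /\<^sub>R norm x)) \<le> norm (f v)"
        using that less.prems by (intro max) (simp add: K_def subspace_scale)
      then have "norm (f x) \<le> norm (f v) * norm x"
        using False assms(1) by (simp add: linear_scale field_simps)
      then show ?thesis
        by (metis norm_ge_zero power_mono power_mult_distrib)
    qed (simp add: linear_0[OF assms(1)])
    define T' where "T' = T \<inter> {w. v \<bullet> w = 0}"
    have T': "subspace T'"
      unfolding T'_def by (rule subspace_orthogonal_slice[OF less.prems])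
    have "v \<notin> T'"
      using vT by (auto simp: T'_def norm_eq_1)
    then have "T' \<subset> T"
      using vT(1) unfolding T'_def by blast
    then have "dim T' < dim T"
      using T' less.prems by (metis dim_psubset span_eq_iff)
    then obtain E where E: "orthonormal E" "span E = T'" "pairwise (\<lambda>x y. f x \<bullet> f y = 0) E"
      using less.hyps T' by blast
    have "f v \<bullet> f w = 0" if "w \<in> E" for w
    proof (rule first_order_optimality[OF assms(1) vT(2)])
      have w: "w \<in> T'" using that E(2) span_superset by blast
      then show "v \<bullet> w = 0" by (simp add: T'_def)
      show "(norm (f (v + t *\<^sub>R w)))\<^sup>2 \<le> (norm (f v))\<^sup>2 * (norm (v + t *\<^sub>R w))\<^sup>2" for t
        using w vT less.prems by (intro bound) (auto simp: T'_def intro: subspace_add subspace_scale)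
    qed
    then have "pairwise (\<lambda>x y. f x \<bullet> f y = 0) (insert v E)"
      using E(3) by (auto simp: pairwise_insert inner_commute)
    then show ?thesis
      using orthonormal_insert[OF less.prems vT E(1) E(2)[unfolded T'_def]] by blast
  qed
qed

lemma ex_orthonormal_basis:
  fixes T :: "'a::euclidean_space set"
  assumes "subspace T"
  obtains E where "orthonormal E" "span E = T"
  using ex_orthonormal_diagonal[OF linear_id assms] by blast

text \<open>Prepares exchange arguments, where one chosen unit vector of a basis is replaced and the
  others are kept.\<close>

lemma ex_orthonormal_basis_containing:
  fixes T :: "'a::euclidean_space set"
  assumes "subspace T" "v \<in> T" "norm v = 1"
  obtains E where "orthonormal (insert v E)" "span (insert v E) = T" "v \<notin> E" "E \<subseteq> {w. v \<bullet> w = 0}"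
proof -
  obtain E where E: "orthonormal E" "span E = T \<inter> {w. v \<bullet> w = 0}"
    using ex_orthonormal_basis[OF subspace_orthogonal_slice[OF assms(1)]] by metis
  show thesis
    using orthonormal_insert[OF assms E] E(2) span_superset[of E] that by blast
qed

text \<open>The weights \<open>\<Sum>e\<in>E. (b \<bullet> e)\<^sup>2\<close> of the basis vectors \<open>b\<close> lie in \<open>[0, 1]\<close> and add up to \<open>card E\<close>,
  so the weighted sum of \<open>\<parallel>f b\<parallel>\<^sup>2\<close> is largest with all weight on \<open>F\<close>.\<close>

lemma ky_fan:
  fixes f :: "'a::euclidean_space \<Rightarrow> 'b::real_inner"
  assumes "linear f" "orthonormal B" "span B = UNIV" "pairwise (\<lambda>x y. f x \<bullet> f y = 0) B"
    and "orthonormal E" "F \<subseteq> B" "card E = card F"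
    and top: "\<And>x y. x \<in> F \<Longrightarrow> y \<in> B - F \<Longrightarrow> norm (f y) \<le> norm (f x)"
  shows "(\<Sum>e\<in>E. (norm (f e))\<^sup>2) \<le> (\<Sum>b\<in>F. (norm (f b))\<^sup>2)"
\<comment> \<open>The threshold \<open>\<tau>\<close> below is a minimum over \<open>F\<close>, so
  the empty set, where both sums vanish, goes separately.\<close>
proof (cases "F = {}")
  case True
  then show ?thesis using assms(5,7) orthonormal_finite by fastforce
next
  case False
  have fin: "finite B" "finite E" "finite F"
    using assms orthonormal_finite finite_subset by blast+
  define s where "s b = (norm (f b))\<^sup>2" for b
  define w where "w b = (\<Sum>e\<in>E. (b \<bullet> e)\<^sup>2)" for b
  have w_le: "w b \<le> 1" if "b \<in> B" for b
  proof -
    obtain E' where E': "orthonormal E'" "span E' = {y. \<forall>x\<in>E. orthogonal x y}"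
      using ex_orthonormal_basis[OF subspace_orthogonal_to_vectors] by metis
    have "E' \<subseteq> {y. \<forall>x\<in>E. orthogonal x y}"
      using E'(2) span_superset by blast
    then have un: "orthonormal (E \<union> E')"
      using assms(5) E'(1) by (intro orthonormal_Un) (auto simp: orthogonal_def)
    \<comment> \<open>\<open>p\<close> is the orthogonal projection of \<open>b\<close> onto
      \<open>span E\<close>; its squared norm is the weight \<open>w b\<close>, and Cauchy-Schwarz
      bounds it by that of \<open>b\<close>.\<close>
    define p where "p = (\<Sum>e\<in>E. (b \<bullet> e) *\<^sub>R e)"
    have p: "p \<bullet> e = b \<bullet> e" if "e \<in> E" for e
    proof -
      have "p \<bullet> e = (\<Sum>e'\<in>E. if e' = e then b \<bullet> e else 0)"
        unfolding p_def inner_sum_left using that assms(5)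
        by (intro sum.cong) (auto simp: orthonormal_inner)
      then show ?thesis using that fin by simp
    qed
    have "p \<in> span E"
      unfolding p_def by (intro span_sum span_scale span_base)
    then have w_eq: "w b = (norm p)\<^sup>2"
      using orthonormal_parseval[OF assms(5), of p] p by (simp add: w_def)
    have "p \<bullet> p = b \<bullet> p"
    proof -
      have "p \<bullet> p = (\<Sum>e\<in>E. (b \<bullet> e) * (p \<bullet> e))"
        by (subst (2) p_def) (simp add: inner_sum_right)
      also have "\<dots> = (\<Sum>e\<in>E. (b \<bullet> e) * (b \<bullet> e))"
        using p by simp
      also have "\<dots> = b \<bullet> p"
        unfolding p_def by (simp add: inner_sum_right)
      finally show ?thesis .
    qed
    then have "(norm p)\<^sup>2 \<le> norm b * norm p"
      by (simp add: power2_norm_eq_inner norm_cauchy_schwarz)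
    then have "norm p \<le> 1"
      using orthonormal_norm[OF assms(2) that]
      by (cases "norm p = 0") (simp_all add: power2_eq_square)
    then show ?thesis
      by (simp add: w_eq power_le_one)
  qed
  have w_ge: "0 \<le> w b" for b
    by (simp add: w_def sum_nonneg)
  \<comment> \<open>Double counting: for each \<open>e\<close>, the squared coordinates in the basis
    \<open>B\<close> add up to 1.\<close>
  have sum_w: "(\<Sum>b\<in>B. w b) = card F"
  proof -
    have "(\<Sum>b\<in>B. w b) = (\<Sum>e\<in>E. \<Sum>b\<in>B. (e \<bullet> b)\<^sup>2)"
      unfolding w_def by (subst sum.swap) (simp add: inner_commute)
    also have "\<dots> = (\<Sum>e\<in>E. 1)"
      using assms by (intro sum.cong) (auto simp: orthonormal_parseval orthonormal_norm)
    finally show ?thesis using assms(7) by simp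
  qed
  have "(\<Sum>e\<in>E. (norm (f e))\<^sup>2) = (\<Sum>e\<in>E. \<Sum>b\<in>B. (e \<bullet> b)\<^sup>2 * s b)"
  proof (intro sum.cong refl)
    fix e
    show "(norm (f e))\<^sup>2 = (\<Sum>b\<in>B. (e \<bullet> b)\<^sup>2 * s b)"
      unfolding s_def
      by (subst linear_expand[OF assms(1,2)]) (use assms(3,4) fin in \<open>auto simp: norm_sq_sum_orthogonal\<close>)
  qed
  also have "\<dots> = (\<Sum>b\<in>B. w b * s b)"
    by (subst sum.swap) (simp add: w_def sum_distrib_right inner_commute)
  finally have lhs: "(\<Sum>e\<in>E. (norm (f e))\<^sup>2) = (\<Sum>b\<in>B. w b * s b)" .
  \<comment> \<open>A value separating \<open>s\<close> on \<open>F\<close> from \<open>s\<close>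
    off \<open>F\<close>. The weight placed outside \<open>F\<close> equals the weight missing
    inside \<open>F\<close>, and moving it across at price \<open>\<tau>\<close> cannot decrease the
    sum.\<close>
  define \<tau> where "\<tau> = Min (s ` F)"
  have \<tau>F: "\<tau> \<le> s b" if "b \<in> F" for b
    using that fin by (simp add: \<tau>_def)
  have \<tau>B: "s b \<le> \<tau>" if "b \<in> B - F" for b
    using that fin False top by (auto simp: \<tau>_def s_def)
  have "(\<Sum>b\<in>B. w b * s b) = (\<Sum>b\<in>F. w b * s b) + (\<Sum>b\<in>B - F. w b * s b)"
    using assms(6) fin by (metis sum.subset_diff add.commute)
  also have "(\<Sum>b\<in>B - F. w b * s b) \<le> (\<Sum>b\<in>B - F. w b * \<tau>)"
    using \<tau>B w_ge by (intro sum_mono mult_left_mono)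
  also have "(\<Sum>b\<in>B - F. w b * \<tau>) = (\<Sum>b\<in>F. (1 - w b) * \<tau>)"
  proof -
    have "(\<Sum>b\<in>B - F. w b) = (\<Sum>b\<in>F. 1 - w b)"
      using sum_w sum.subset_diff[OF assms(6) fin(1), of w] by (simp add: sum_subtractf)
    then show ?thesis by (simp flip: sum_distrib_right)
  qed
  also have "(\<Sum>b\<in>F. (1 - w b) * \<tau>) \<le> (\<Sum>b\<in>F. (1 - w b) * s b)"
    using \<tau>F w_le assms(6) by (intro sum_mono mult_left_mono) auto
  finally have "(\<Sum>b\<in>B. w b * s b) \<le> (\<Sum>b\<in>F. w b * s b) + (\<Sum>b\<in>F. (1 - w b) * s b)"
    by simp
  also have "\<dots> = (\<Sum>b\<in>F. s b)"
    by (simp add: algebra_simps flip: sum.distrib)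
  finally show ?thesis
    using lhs by (simp add: s_def)
qed

text \<open>The bounds \<open>upper\<close> and \<open>lower\<close> say that \<open>R\<close> is
  optimal among subspaces of its dimension. Replacing \<open>x\<close> in a basis of
  \<open>R\<close> by another unit vector therefore cannot increase the sum, and rotating
  \<open>x\<close> towards \<open>y\<close> gives a first-order condition.\<close>

lemma maximal_subspace_exchange:
  fixes f :: "'a::euclidean_space \<Rightarrow> 'b::real_inner"
  assumes "linear f" "subspace R"
    and upper: "\<And>E. orthonormal E \<Longrightarrow> card E = dim R \<Longrightarrow> (\<Sum>e\<in>E. (norm (f e))\<^sup>2) \<le> K"
    and lower: "\<And>E. orthonormal E \<Longrightarrow> span E = R \<Longrightarrow> K \<le> (\<Sum>e\<in>E. (norm (f e))\<^sup>2)"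
    and "x \<in> R" "norm x = 1" "norm y = 1" "\<And>z. z \<in> R \<Longrightarrow> z \<bullet> y = 0"
  shows "f x \<bullet> f y = 0" "norm (f y) \<le> norm (f x)"
proof -
  obtain E where E: "orthonormal (insert x E)" "span (insert x E) = R" "x \<notin> E" "E \<subseteq> {w. x \<bullet> w = 0}"
    using ex_orthonormal_basis_containing[OF assms(2,5,6)] by metis
  have fin: "finite E" using orthonormal_finite[OF E(1)] by simp
  have ER: "E \<subseteq> R" using E(2) span_superset by blast
  have cardE: "Suc (card E) = dim R"
    using orthonormal_card[OF E(1)] E(2,3) fin by simp
  \<comment> \<open>The set with \<open>z\<close> obeys the bound \<open>K\<close>, the one with
    \<open>x\<close> reaches it, and the terms over \<open>E\<close> cancel. This is applied to
    \<open>y\<close> and to the normalized \<open>x + t y\<close>.\<close>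
  have unit: "norm (f z) \<le> norm (f x)" if "norm z = 1" "\<And>e. e \<in> E \<Longrightarrow> z \<bullet> e = 0" for z
  proof -
    have "orthonormal ({z} \<union> E)" "{z} \<inter> E = {}"
      using that orthonormal_subset[OF E(1), of E]
      by (intro orthonormal_Un; auto simp: orthonormal_def)+
    then have "z \<notin> E" and "(\<Sum>e\<in>insert z E. (norm (f e))\<^sup>2) \<le> K"
      using cardE fin upper[of "insert z E"] by auto
    note this(2)
    also have "K \<le> (\<Sum>e\<in>insert x E. (norm (f e))\<^sup>2)"
      using E by (intro lower)
    finally show ?thesis
      using fin E(3) \<open>z \<notin> E\<close> by simp
  qed
  have y: "y \<bullet> e = 0" if "e \<in> E" for e
    using assms(8)[of e] ER that by (auto simp: inner_commute)
  show "norm (f y) \<le> norm (f x)"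
    using assms(7) y by (rule unit)
  have xy: "x \<bullet> y = 0" using assms(5,8) by blast
  show "f x \<bullet> f y = 0"
  proof (rule first_order_optimality[OF assms(1,6) xy])
    fix t :: real
    define z where "z = x + t *\<^sub>R y"
    have ze: "z \<bullet> e = 0" if "e \<in> E" for e
      using that E(4) y by (auto simp: z_def inner_add_left)
    have "z \<bullet> x = 1"
      using xy assms(6) by (simp add: z_def inner_add_left inner_commute[of y x] norm_eq_1)
    then have "z \<noteq> 0" by auto
    then have "norm (f (z /\<^sub>R norm z)) \<le> norm (f x)"
      using ze by (intro unit) auto
    then have "norm (f z) \<le> norm (f x) * norm z"
      using \<open>z \<noteq> 0\<close> assms(1) by (simp add: linear_scale field_simps)
    then have "(norm (f z))\<^sup>2 \<le> (norm (f x))\<^sup>2 * (norm z)\<^sup>2"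
      by (metis norm_ge_zero power_mono power_mult_distrib)
    then show "(norm (f (x + t *\<^sub>R y)))\<^sup>2 \<le> (norm (f x))\<^sup>2 * (norm (x + t *\<^sub>R y))\<^sup>2"
      by (simp add: z_def)
  qed
qed

subsection \<open>The residual of a pair of adapters\<close>

declare transpose_matrix_vector [simp del]

lemma inner_matrix_vector:
  fixes M :: "real^'n^'m"
  shows "(M *v x) \<bullet> y = x \<bullet> (transpose M *v y)"
  by (metis dot_lmul_matrix inner_commute transpose_matrix_vector)

lemma inner_gram_commute:
  fixes M :: "real^'n^'m"
  shows "(M *v (transpose M *v x)) \<bullet> y = x \<bullet> (M *v (transpose M *v y))"
  using inner_matrix_vector[of M "transpose M *v x" y] inner_matrix_vector[of M "transpose M *v y" x]
  by (simp add: inner_commute)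

text \<open>Parseval is applied to each row, and the two sums are exchanged.\<close>

lemma norm_sq_matrix_orthonormal:
  fixes N :: "real^'n^'m"
  assumes "orthonormal E" "span E = UNIV"
  shows "(norm N)\<^sup>2 = (\<Sum>e\<in>E. (norm (N *v e))\<^sup>2)"
proof -
  have "(norm N)\<^sup>2 = (\<Sum>i\<in>UNIV. (norm (N $ i))\<^sup>2)"
    by (simp add: power2_norm_eq_inner inner_vec_def[of N N])
  also have "\<dots> = (\<Sum>i\<in>UNIV. \<Sum>e\<in>E. (N $ i \<bullet> e)\<^sup>2)"
    using assms by (simp add: orthonormal_parseval)
  also have "\<dots> = (\<Sum>e\<in>E. \<Sum>i\<in>UNIV. (N $ i \<bullet> e)\<^sup>2)"
    by (rule sum.swap)
  also have "\<dots> = (\<Sum>e\<in>E. (norm (N *v e))\<^sup>2)"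
  proof (rule sum.cong[OF refl])
    fix e
    show "(\<Sum>i\<in>UNIV. (N $ i \<bullet> e)\<^sup>2) = (norm (N *v e))\<^sup>2"
      unfolding power2_norm_eq_inner
      by (subst (2) inner_vec_def) (simp add: matrix_mult_dot power2_eq_square)
  qed
  finally show ?thesis .
qed

lemma pairwise_Un_sym:
  assumes "pairwise P S" "pairwise P T" "\<And>x y. x \<in> S \<Longrightarrow> y \<in> T \<Longrightarrow> P x y"
    and "\<And>x y. P x y \<Longrightarrow> P y x"
  shows "pairwise P (S \<union> T)"
  using assms unfolding pairwise_def by blast

lemma ex_orthogonal_complement_basis:
  fixes E :: "'a::euclidean_space set"
  assumes "orthonormal E"
  obtains F where "orthonormal F" "orthonormal (E \<union> F)" "E \<inter> F = {}" "span (E \<union> F) = UNIV"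
    "\<And>x y. x \<in> span E \<Longrightarrow> y \<in> F \<Longrightarrow> x \<bullet> y = 0"
proof -
  let ?C = "{y. \<forall>x\<in>span E. orthogonal x y}"
  obtain F where F: "orthonormal F" "span F = ?C"
    using ex_orthonormal_basis[OF subspace_orthogonal_to_vectors] by metis
  have EF: "x \<bullet> y = 0" if "x \<in> span E" "y \<in> F" for x y
    using F(2) span_superset[of F] that by (auto simp: orthogonal_def)
  have un: "orthonormal (E \<union> F)" "E \<inter> F = {}"
    using orthonormal_Un[OF assms F(1)] EF span_base by blast+
  have "card (E \<union> F) = card E + card F"
    using un(2) orthonormal_finite assms F(1) by (intro card_Un_disjoint)
  also have "card F = dim ?C"
    using orthonormal_card[OF F(1)] F(2) by simp
  also have "card E + dim ?C = DIM('a)"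
    using dim_subspace_orthogonal_to_vectors[of "span E" UNIV] orthonormal_card[OF assms] by simp
  finally have "span (E \<union> F) = UNIV"
    by (rule orthonormal_span_UNIV[OF un(1)])
  with F un EF that show thesis by blast
qed

text \<open>Part of an orthonormal basis of the complement pads \<open>Z\<close> to the exact
  dimension \<open>k\<close>.\<close>

lemma ex_superspace:
  fixes Z :: "'a::euclidean_space set"
  assumes "subspace Z" "dim Z \<le> k" "k \<le> DIM('a)"
  obtains R where "subspace R" "Z \<subseteq> R" "dim R = k"
proof -
  obtain E where E: "orthonormal E" "span E = Z"
    using ex_orthonormal_basis[OF assms(1)] by metis
  obtain F where F: "orthonormal F" "orthonormal (E \<union> F)" "E \<inter> F = {}" "span (E \<union> F) = UNIV"
    using ex_orthogonal_complement_basis[OF E(1)] by metis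
  have cE: "card E = dim Z"
    using orthonormal_card[OF E(1)] E(2) by simp
  have "card E + card F = DIM('a)"
    using orthonormal_card_UNIV[OF F(2,4)] F(3) E(1) F(1)
    by (simp add: card_Un_disjoint orthonormal_finite)
  then have "k - card E \<le> card F"
    using assms(3) by simp
  then obtain F' where F': "F' \<subseteq> F" "card F' = k - card E"
    by (meson obtain_subset_with_card_n)
  have EF': "orthonormal (E \<union> F')"
    using orthonormal_subset[OF F(2)] F'(1) by blast
  have "card (E \<union> F') = card E + card F'"
    using F'(1) F(3) EF' by (intro card_Un_disjoint) (auto dest: orthonormal_finite)
  then have "dim (span (E \<union> F')) = k"
    using orthonormal_card[OF EF'] F'(2) cE assms(2) by simp
  moreover have "Z \<subseteq> span (E \<union> F')"
    unfolding E(2)[symmetric] by (intro span_mono) blast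
  ultimately show thesis
    using that subspace_span by blast
qed

text \<open>The matrix inside the objective, up to the factor \<open>1 / L\<close>, once the
  adapters have been divided by \<open>1 / sqrt (L * \<eta>)\<close>.\<close>

definition residual :: "real^'n^'m \<Rightarrow> real^'r^'m \<Rightarrow> real^'r^'n \<Rightarrow> real^'n^'m" where
  "residual G A B = G - G ** B ** transpose B - A ** transpose A ** G"

lemma residual_apply:
  "residual G A B *v x =
    G *v x - G *v (B *v (transpose B *v x)) - A *v (transpose A *v (G *v x))"
  by (simp add: residual_def matrix_vector_mult_diff_rdistrib matrix_vector_mul_assoc
      matrix_mul_assoc)

lemma dim_range_matrix_le:
  fixes B :: "real^'r^'n" and S :: "(real^'r) set"
  shows "dim ((*v) B ` S) \<le> CARD('r)"
  using dim_image_le[of "(*v) B" S] dim_subset_UNIV[of S] by simp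

text \<open>The two ranges have dimension at most \<open>r\<close> each. Their sum is padded to
  dimension exactly \<open>2r\<close>, so that Ky Fan's bound with \<open>2r\<close> vectors applies
  to every orthonormal basis of \<open>R\<close>.\<close>

lemma ex_adapter_subspace:
  fixes G :: "real^'n^'m" and A :: "real^'r^'m" and B :: "real^'r^'n"
  assumes "2 * CARD('r) \<le> CARD('n)"
  obtains R where "subspace R" "dim R = 2 * CARD('r)"
    "\<And>z. B *v z \<in> R" "\<And>z. transpose G *v (A *v z) \<in> R"
proof -
  let ?Z1 = "range ((*v) B)" and ?Z2 = "range ((*v) (transpose G ** A))"
  let ?Z = "{x + y |x y. x \<in> ?Z1 \<and> y \<in> ?Z2}"
  have sub: "subspace ?Z1" "subspace ?Z2"
    by (intro linear_subspace_image; simp)+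
  have "dim ?Z \<le> dim ?Z1 + dim ?Z2"
    using dim_sums_Int[OF sub] by linarith
  also have "\<dots> \<le> 2 * CARD('r)"
    using dim_range_matrix_le[of B UNIV] dim_range_matrix_le[of "transpose G ** A" UNIV] by simp
  finally have d: "dim ?Z \<le> 2 * CARD('r)" .
  obtain R where R: "subspace R" "?Z \<subseteq> R" "dim R = 2 * CARD('r)"
    using ex_superspace[OF subspace_sums[OF sub] d] assms by auto
  have "B *v z \<in> R" for z
  proof -
    have "B *v z + (transpose G ** A) *v 0 \<in> ?Z" by blast
    then show ?thesis using R(2) by auto
  qed
  moreover have "transpose G *v (A *v z) \<in> R" for z
  proof -
    have "B *v 0 + (transpose G ** A) *v z \<in> ?Z" by blast
    then show ?thesis using R(2) by (auto simp: matrix_vector_mul_assoc)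
  qed
  ultimately show thesis using that R by blast
qed

lemma norm_sq_residual:
  fixes G :: "real^'n^'m" and A :: "real^'r^'m" and B :: "real^'r^'n"
  assumes "\<And>z. B *v z \<in> R" "\<And>z. transpose G *v (A *v z) \<in> R" "orthonormal E" "span E = R"
  shows "(norm (residual G A B))\<^sup>2 =
    (norm G)\<^sup>2 - (\<Sum>e\<in>E. (norm (G *v e))\<^sup>2) + (\<Sum>e\<in>E. (norm (residual G A B *v e))\<^sup>2)"
proof -
  obtain F where F: "orthonormal F" "orthonormal (E \<union> F)" "E \<inter> F = {}" "span (E \<union> F) = UNIV"
    "\<And>x y. x \<in> span E \<Longrightarrow> y \<in> F \<Longrightarrow> x \<bullet> y = 0"
    by (rule ex_orthogonal_complement_basis[OF assms(3)]) blast
  have fin: "finite E" "finite F"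
    using assms(3) F(1) orthonormal_finite by blast+
  have split: "(norm N)\<^sup>2 = (\<Sum>e\<in>E. (norm (N *v e))\<^sup>2) + (\<Sum>e\<in>F. (norm (N *v e))\<^sup>2)"
    for N :: "real^'n^'m"
    using norm_sq_matrix_orthonormal[OF F(2,4)] fin F(3) by (simp add: sum.union_disjoint)
  \<comment> \<open>A vector orthogonal to the ranges of \<open>B\<close> and \<open>G^T A\<close>
    is killed by \<open>B^T\<close> and by \<open>A^T G\<close>, so both correction terms vanish on
    it.\<close>
  have "residual G A B *v e = G *v e" if "e \<in> F" for e
  proof -
    have perp: "z \<bullet> e = 0" if "z \<in> R" for z
      using F(5) that \<open>e \<in> F\<close> assms(4) by blast
    have "transpose B *v e = 0"
      using perp[OF assms(1)] by (metis inner_eq_zero_iff inner_matrix_vector)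
    moreover have "transpose A *v (G *v e) = 0"
      using perp[OF assms(2)] by (metis inner_eq_zero_iff inner_matrix_vector transpose_transpose)
    ultimately show ?thesis by (simp add: residual_apply)
  qed
  with split[of "residual G A B"] split[of G] show ?thesis by simp
qed

lemma residual_lower_bound:
  fixes G :: "real^'n^'m" and A :: "real^'r^'m" and B :: "real^'r^'n"
  assumes "2 * CARD('r) \<le> CARD('n)"
    and upper: "\<And>E. orthonormal E \<Longrightarrow> card E = 2 * CARD('r) \<Longrightarrow> (\<Sum>e\<in>E. (norm (G *v e))\<^sup>2) \<le> K"
  shows "(norm G)\<^sup>2 - K \<le> (norm (residual G A B))\<^sup>2"
proof -
  obtain R where R: "subspace R" "dim R = 2 * CARD('r)"
    "\<And>z. B *v z \<in> R" "\<And>z. transpose G *v (A *v z) \<in> R"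
    using ex_adapter_subspace[OF assms(1)] by metis
  obtain E where E: "orthonormal E" "span E = R"
    using ex_orthonormal_basis[OF R(1)] by metis
  have "(\<Sum>e\<in>E. (norm (G *v e))\<^sup>2) \<le> K"
    using E R(2) by (intro upper) (auto simp: orthonormal_card)
  moreover have "0 \<le> (\<Sum>e\<in>E. (norm (residual G A B *v e))\<^sup>2)"
    by (simp add: sum_nonneg)
  ultimately show ?thesis
    using norm_sq_residual[OF R(3,4) E] by linarith
qed

text \<open>The equality case of \<open>residual_lower_bound\<close>. With \<open>Y = B B^T\<close>,
  the sets are bases of \<open>Y R\<close> (\<open>E1\<close>), of \<open>(1 - Y) R\<close>
  (\<open>E2\<close>) and of the orthogonal complement of \<open>R\<close> (\<open>E3\<close>): the
  directions handled by \<open>B\<close>, those handled by \<open>A\<close>, and those left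
  over.\<close>

lemma residual_minimal_structure:
  fixes G :: "real^'n^'m" and A :: "real^'r^'m" and B :: "real^'r^'n"
  assumes rank: "2 * CARD('r) \<le> rank G"
    and upper: "\<And>E. orthonormal E \<Longrightarrow> card E = 2 * CARD('r) \<Longrightarrow> (\<Sum>e\<in>E. (norm (G *v e))\<^sup>2) \<le> K"
    and min: "(norm (residual G A B))\<^sup>2 \<le> (norm G)\<^sup>2 - K"
  obtains E1 E2 E3 where
    "orthonormal (E1 \<union> E2 \<union> E3)" "span (E1 \<union> E2 \<union> E3) = UNIV"
    "card E1 = CARD('r)" "card E2 = CARD('r)" "E1 \<inter> E2 = {}" "(E1 \<union> E2) \<inter> E3 = {}"
    "pairwise (\<lambda>x y. (G *v x) \<bullet> (G *v y) = 0) (E1 \<union> E2 \<union> E3)"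
    "\<And>x. x \<in> E1 \<Longrightarrow> B *v (transpose B *v x) = x"
    "\<And>x. x \<in> E2 \<Longrightarrow> A *v (transpose A *v (G *v x)) = G *v x"
    "\<And>x. x \<in> E1 \<union> E2 \<Longrightarrow> G *v x \<noteq> 0"
    "\<And>x y. x \<in> E1 \<union> E2 \<Longrightarrow> y \<in> E3 \<Longrightarrow> norm (G *v y) \<le> norm (G *v x)"
proof -
  let ?r = "CARD('r)"
  have "2 * ?r \<le> CARD('n)"
    using rank rank_bound[of G] by linarith
  then obtain R where R: "subspace R" "dim R = 2 * ?r"
    "\<And>z. B *v z \<in> R" "\<And>z. transpose G *v (A *v z) \<in> R"
    using ex_adapter_subspace by metis
  have lin: "linear ((*v) G)" by simp
  \<comment> \<open>Minimality squeezes both estimates behind the lower bound: \<open>R\<close>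
    attains the Ky Fan value, and the residual has no part on \<open>R\<close>.\<close>
  have lower: "K \<le> (\<Sum>e\<in>E. (norm (G *v e))\<^sup>2)"
    and zero: "(\<Sum>e\<in>E. (norm (residual G A B *v e))\<^sup>2) \<le> 0" if E: "orthonormal E" "span E = R" for E
  proof -
    have "(\<Sum>e\<in>E. (norm (G *v e))\<^sup>2) \<le> K"
      using E R(2) by (intro upper) (auto simp: orthonormal_card)
    moreover have "0 \<le> (\<Sum>e\<in>E. (norm (residual G A B *v e))\<^sup>2)"
      by (simp add: sum_nonneg)
    ultimately show "K \<le> (\<Sum>e\<in>E. (norm (G *v e))\<^sup>2)" "(\<Sum>e\<in>E. (norm (residual G A B *v e))\<^sup>2) \<le> 0"
      using norm_sq_residual[OF R(3,4) E] min by linarith+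
  qed
  have exch: "(G *v x) \<bullet> (G *v y) = 0" "norm (G *v y) \<le> norm (G *v x)"
    if "x \<in> R" "norm x = 1" "norm y = 1" "\<And>z. z \<in> R \<Longrightarrow> z \<bullet> y = 0" for x y
  proof -
    have up: "(\<Sum>e\<in>E. (norm (G *v e))\<^sup>2) \<le> K" if "orthonormal E" "card E = dim R" for E
      using upper that R(2) by simp
    note exch = maximal_subspace_exchange[where f = "(*v) G" and R = R and K = K and x = x and y = y]
    show "(G *v x) \<bullet> (G *v y) = 0"
      by (rule exch(1)) (fact lin R(1) up lower that)+
    show "norm (G *v y) \<le> norm (G *v x)"
      by (rule exch(2)) (fact lin R(1) up lower that)+
  qed
  define Y where "Y x = B *v (transpose B *v x)" for x
  have linY: "linear Y"
    unfolding Y_def by (simp add: matrix_vector_mul_assoc)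
  have YR: "Y x \<in> R" for x using R(3) by (simp add: Y_def)
  have Ysym: "Y x \<bullet> y = x \<bullet> Y y" for x y
    by (simp add: Y_def inner_gram_commute)
  have resid: "residual G A B *v x = 0" if "x \<in> R" for x
  proof -
    obtain E where E: "orthonormal E" "span E = R"
      using ex_orthonormal_basis[OF R(1)] by metis
    have "residual G A B *v e = 0" if "e \<in> E" for e
      using zero[OF E] that orthonormal_finite[OF E(1)]
      by (metis (no_types, lifting) sum_nonneg_eq_0_iff order_antisym sum_nonneg zero_le_power2
          norm_eq_zero power_eq_0_iff)
    then show ?thesis
      using that E(2) linear_eq_0_on_span[of "(*v) (residual G A B)" E x] by simp
  qed
  \<comment> \<open>The vanishing residual, rearranged: on \<open>R\<close>, what \<open>B\<close>
    leaves of \<open>G\<close> is exactly what \<open>A\<close> reproduces.\<close>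
  have eq: "G *v (x - Y x) = A *v (transpose A *v (G *v x))" if "x \<in> R" for x
    using resid[OF that] by (simp add: residual_apply Y_def matrix_vector_mult_diff_distrib)
  \<comment> \<open>If \<open>G\<close> killed a unit vector of \<open>R\<close>, the exchange
    inequality would make it vanish on the complement too, leaving only \<open>2r - 1\<close> basis
    vectors to generate its range, against the rank hypothesis.\<close>
  have inj0: "x = 0" if x: "x \<in> R" "G *v x = 0" for x
  proof (rule ccontr)
    assume "x \<noteq> 0"
    define u where "u = x /\<^sub>R norm x"
    have u: "u \<in> R" "norm u = 1" "G *v u = 0"
      using x \<open>x \<noteq> 0\<close> R(1) by (auto simp: u_def subspace_scale matrix_vector_mult_scaleR)
    obtain E where E: "orthonormal (insert u E)" "span (insert u E) = R" "u \<notin> E"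
      using ex_orthonormal_basis_containing[OF R(1) u(1,2)] by metis
    obtain F where F: "orthonormal F" "orthonormal (insert u E \<union> F)" "insert u E \<inter> F = {}"
      "span (insert u E \<union> F) = UNIV"
      "\<And>x y. x \<in> span (insert u E) \<Longrightarrow> y \<in> F \<Longrightarrow> x \<bullet> y = 0"
      by (rule ex_orthogonal_complement_basis[OF E(1)]) blast
    have finE: "finite E" using orthonormal_finite[OF E(1)] by simp
    have GF: "G *v y = 0" if "y \<in> F" for y
      using exch(2)[OF u(1,2), of y] F(1,5) that E(2) u(3) by (auto simp: orthonormal_norm)
    have "range ((*v) G) = span ((*v) G ` (insert u E \<union> F))"
      using F(4) by (metis linear_span_image lin)
    also have "\<dots> \<subseteq> span ((*v) G ` E)"
      using GF u(3) by (intro span_minimal) (auto intro: span_base span_0)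
    finally have "rank G \<le> dim (span ((*v) G ` E))"
      unfolding rank_dim_range by (rule dim_subset)
    also have "\<dots> \<le> card ((*v) G ` E)"
      using finE by (simp add: dim_le_card')
    also have "\<dots> \<le> card E"
      using finE by (rule card_image_le)
    also have "Suc (card E) = 2 * ?r"
      using orthonormal_card[OF E(1)] E(2,3) finE R(2) by simp
    then have "card E < 2 * ?r" by simp
    finally show False using rank by simp
  qed
  have injG: "inj_on ((*v) G) R"
  proof (rule inj_onI)
    fix x y assume "x \<in> R" "y \<in> R" "G *v x = G *v y"
    then show "x = y"
      using inj0[of "x - y"] R(1) by (simp add: matrix_vector_mult_diff_distrib subspace_diff)
  qed
  define T1 where "T1 = Y ` R"
  define T2 where "T2 = (\<lambda>x. x - Y x) ` R"
  have lin2: "linear (\<lambda>x. x - Y x)"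
    using linY by (intro linear_compose_sub linear_ident)
  have sub: "subspace T1" "subspace T2"
    unfolding T1_def T2_def using linY lin2 R(1) by (intro linear_subspace_image; simp)+
  have T1R: "T1 \<subseteq> R" and T2R: "T2 \<subseteq> R"
    using YR R(1) by (auto simp: T1_def T2_def subspace_diff)
  have "T1 \<subseteq> range ((*v) B)"
    by (auto simp: T1_def Y_def)
  then have d1: "dim T1 \<le> ?r"
    using dim_subset dim_range_matrix_le le_trans by blast
  \<comment> \<open>\<open>T2\<close> is measured through its image: \<open>G\<close> is injective
    on \<open>R\<close>, and by \<open>eq\<close> the image lies in the range of
    \<open>A\<close>.\<close>
  have "dim T2 = dim ((*v) G ` T2)"
    using injG T2R sub(2) lin by (intro dim_image_eq[symmetric])
      (auto simp: span_eq_iff[THEN iffD2] intro: inj_on_subset)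
  also have "(*v) G ` T2 \<subseteq> range ((*v) A)"
    using eq by (auto simp: T2_def)
  then have "dim ((*v) G ` T2) \<le> ?r"
    using dim_subset dim_range_matrix_le le_trans by blast
  finally have d2: "dim T2 \<le> ?r" .
  have "R \<subseteq> {x + y |x y. x \<in> T1 \<and> y \<in> T2}"
  proof
    fix x assume "x \<in> R"
    then have "Y x \<in> T1" "x - Y x \<in> T2" by (auto simp: T1_def T2_def)
    moreover have "x = Y x + (x - Y x)" by simp
    ultimately show "x \<in> {x + y |x y. x \<in> T1 \<and> y \<in> T2}" by blast
  qed
  then have "2 * ?r \<le> dim {x + y |x y. x \<in> T1 \<and> y \<in> T2}"
    unfolding R(2)[symmetric] by (rule dim_subset)
  \<comment> \<open>The sum has dimension at least \<open>2r\<close> and each summand at most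
    \<open>r\<close>, so equality holds throughout and the sum is direct.\<close>
  then have dims: "dim T1 = ?r" "dim T2 = ?r" "dim (T1 \<inter> T2) = 0"
    using dim_sums_Int[OF sub] d1 d2 by linarith+
  \<comment> \<open>\<open>Y x - Y (Y x)\<close> lies in both \<open>T1\<close> and
    \<open>T2\<close>, hence is zero: \<open>Y\<close> is a projection on \<open>R\<close>.\<close>
  have YY: "Y (Y x) = Y x" if "x \<in> R" for x
  proof -
    have "Y x - Y (Y x) \<in> T2" using YR by (auto simp: T2_def)
    moreover have "Y x - Y (Y x) = Y (x - Y x)" using linY by (simp add: linear_diff)
    moreover have "Y (x - Y x) \<in> T1" using that YR R(1) by (auto simp: T1_def subspace_diff)
    ultimately show ?thesis using dims(3) by (auto simp: dim_eq_0)
  qed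
  have Y1: "Y x = x" if "x \<in> T1" for x using that YY by (auto simp: T1_def)
  have Y2: "Y x = 0" if "x \<in> T2" for x using that YY linY by (auto simp: T2_def linear_diff)
  \<comment> \<open>\<open>A A^T\<close> is symmetric, so by \<open>eq\<close> the form
    \<open>(G x) \<bullet> (G (y - Y y))\<close> is symmetric on \<open>R\<close>; this is the
    commutation of \<open>G^T G\<close> with \<open>Y\<close> there.\<close>
  have GY: "(G *v x) \<bullet> (G *v Y y) = (G *v Y x) \<bullet> (G *v y)" if "x \<in> R" "y \<in> R" for x y
  proof -
    have "(G *v x) \<bullet> (G *v (y - Y y)) = (G *v (x - Y x)) \<bullet> (G *v y)"
      unfolding eq[OF that(1)] eq[OF that(2)] by (simp add: inner_gram_commute)
    then show ?thesis
      by (simp add: matrix_vector_mult_diff_distrib inner_diff_left inner_diff_right)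
  qed
  \<comment> \<open>\<open>Y\<close> is 1 on \<open>T1\<close> and 0 on \<open>T2\<close>; its
    symmetry for the inner product, and by \<open>GY\<close> for the form of \<open>G^T G\<close>,
    separates the two spaces.\<close>
  have orth12: "x \<bullet> y = 0" "(G *v x) \<bullet> (G *v y) = 0" if "x \<in> T1" "y \<in> T2" for x y
  proof -
    show "x \<bullet> y = 0"
      using Ysym[of x y] Y1 Y2 that by simp
    show "(G *v x) \<bullet> (G *v y) = 0"
      using GY[of x y] Y1 Y2 that T1R T2R by (simp add: subset_iff)
  qed
  obtain E1 where E1: "orthonormal E1" "span E1 = T1" "pairwise (\<lambda>x y. (G *v x) \<bullet> (G *v y) = 0) E1"
    using ex_orthonormal_diagonal[OF lin sub(1)] by metis
  obtain E2 where E2: "orthonormal E2" "span E2 = T2" "pairwise (\<lambda>x y. (G *v x) \<bullet> (G *v y) = 0) E2"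
    using ex_orthonormal_diagonal[OF lin sub(2)] by metis
  have sup: "E1 \<subseteq> T1" "E2 \<subseteq> T2" using E1(2) E2(2) span_superset by blast+
  have E12: "orthonormal (E1 \<union> E2)" "E1 \<inter> E2 = {}"
    using orthonormal_Un[OF E1(1) E2(1)] orth12(1) sup by blast+
  have cards: "card E1 = ?r" "card E2 = ?r"
    using orthonormal_card[OF E1(1)] orthonormal_card[OF E2(1)] E1(2) E2(2) dims by simp_all
  have "card (E1 \<union> E2) = 2 * ?r"
    using cards E12(2) E1(1) E2(1) by (simp add: card_Un_disjoint orthonormal_finite)
  then have "dim (span (E1 \<union> E2)) = 2 * ?r"
    using orthonormal_card[OF E12(1)] by simp
  moreover have "span (E1 \<union> E2) \<subseteq> R"
    using sup T1R T2R R(1) by (intro span_minimal) auto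
  ultimately have spanR: "span (E1 \<union> E2) = R"
    using R by (intro subspace_dim_equal) auto
  define C where "C = {y. \<forall>x\<in>R. orthogonal x y}"
  have subC: "subspace C"
    unfolding C_def by (rule subspace_orthogonal_to_vectors)
  obtain E3 where E3: "orthonormal E3" "span E3 = C" "pairwise (\<lambda>x y. (G *v x) \<bullet> (G *v y) = 0) E3"
    using ex_orthonormal_diagonal[OF lin subC] by blast
  have perp: "x \<bullet> y = 0" if "x \<in> R" "y \<in> E3" for x y
    using that E3(2) span_superset[of E3] by (auto simp: C_def orthogonal_def)
  have E12R: "E1 \<union> E2 \<subseteq> R" using spanR span_superset by blast
  have E123: "orthonormal (E1 \<union> E2 \<union> E3)" "(E1 \<union> E2) \<inter> E3 = {}"
    using orthonormal_Un[OF E12(1) E3(1)] perp E12R by blast+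
  have G13: "(G *v x) \<bullet> (G *v y) = 0" "norm (G *v y) \<le> norm (G *v x)"
    if "x \<in> E1 \<union> E2" "y \<in> E3" for x y
    using exch[of x y] that E12R perp E12(1) E3(1) by (auto simp: orthonormal_norm)
  show thesis
  proof (rule that[OF E123(1) _ cards E12(2) E123(2)])
    show "span (E1 \<union> E2 \<union> E3) = UNIV"
    proof (rule orthonormal_span_UNIV[OF E123(1)])
      have "card (E1 \<union> E2 \<union> E3) = card (E1 \<union> E2) + card E3"
        using E123 by (intro card_Un_disjoint) (auto dest: orthonormal_finite)
      moreover have "card (E1 \<union> E2) = dim R"
        using orthonormal_card[OF E12(1)] spanR by simp
      moreover have "card E3 = dim C"
        using orthonormal_card[OF E3(1)] E3(2) by simp
      moreover have "dim C + dim R = DIM(real^'n)"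
        using dim_subspace_orthogonal_to_vectors[of R UNIV] R(1) by (simp add: C_def)
      ultimately show "card (E1 \<union> E2 \<union> E3) = DIM(real^'n)" by simp
    qed
    show "pairwise (\<lambda>x y. (G *v x) \<bullet> (G *v y) = 0) (E1 \<union> E2 \<union> E3)"
      using E1(3) E2(3) E3(3) orth12(2) sup G13(1)
      by (intro pairwise_Un_sym) (auto simp: inner_commute)
    show "B *v (transpose B *v x) = x" if "x \<in> E1" for x
      using Y1 that sup by (auto simp: Y_def)
    show "A *v (transpose A *v (G *v x)) = G *v x" if "x \<in> E2" for x
    proof -
      have "x \<in> R" "Y x = 0" using that sup T2R Y2 by blast+
      then show ?thesis using eq[of x] by simp
    qed
    show "G *v x \<noteq> 0" if "x \<in> E1 \<union> E2" for x
      using inj0[of x] that E12R orthonormal_norm[OF E12(1) that] by auto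
  qed (use G13 in blast)
qed

subsection \<open>Singular value decompositions\<close>

lemma inj_pos: "inj (pos :: 'a::{finite,wellorder} \<Rightarrow> nat)"
  using bij_betw_pos by (rule bij_betw_imp_inj_on)

lemma pos_eq_iff [simp]: "pos i = pos j \<longleftrightarrow> i = j"
  using inj_eq[OF inj_pos] .

lemma pos_bounds: "1 \<le> pos i" "pos (i :: 'a::{finite,wellorder}) \<le> CARD('a)"
  using bij_betw_pos[where 'a = 'a] by (auto simp: bij_betw_def)

lemma kth_pos:
  assumes "pos (i :: 'a::{finite,wellorder}) = k"
  shows "kth UNIV k = i"
proof -
  have "pos (kth UNIV k :: 'a) = k"
    using assms pos_bounds[of i] by (intro pos_kth) auto
  then show ?thesis using assms by (metis pos_eq_iff)
qed

lemma pos_image: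
  assumes "I \<subseteq> {1..CARD('a)}"
  shows "pos ` {i :: 'a::{finite,wellorder}. pos i \<in> I} = I"
proof
  show "I \<subseteq> pos ` {i :: 'a. pos i \<in> I}"
  proof
    fix k assume "k \<in> I"
    then have "pos (kth UNIV k :: 'a) = k"
      using assms by (intro pos_kth) auto
    then show "k \<in> pos ` {i :: 'a. pos i \<in> I}"
      using \<open>k \<in> I\<close> by (metis (mono_tags) imageI mem_Collect_eq)
  qed
qed auto

lemma card_pos:
  assumes "I \<subseteq> {1..CARD('a)}"
  shows "card {i :: 'a::{finite,wellorder}. pos i \<in> I} = card I"
  using pos_image[OF assms] inj_pos by (metis card_image inj_on_subset subset_UNIV)

lemma card_pos_le:
  assumes "k \<le> CARD('a)"
  shows "card {i :: 'a::{finite,wellorder}. pos i \<le> k} = k"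
proof -
  have "{i :: 'a. pos i \<le> k} = {i. pos i \<in> {1..k}}"
    using pos_bounds(1) by auto
  then show ?thesis using card_pos[where 'a = 'a, of "{1..k}"] assms by simp
qed

text \<open>An initial segment of the ordered index type is determined by its cardinality. It is
  applied to the indices with nonzero singular value.\<close>

lemma down_closed_pos:
  fixes N :: "'a::{finite,wellorder} set"
  assumes "\<And>i j. j \<in> N \<Longrightarrow> pos i \<le> pos j \<Longrightarrow> i \<in> N"
  shows "j \<in> N \<longleftrightarrow> pos j \<le> card N"
proof
  assume "j \<in> N"
  have "i \<in> N" if "i \<le> j" for i
  proof (cases "i = j")
    case False
    then have "pos i < pos j" using that by (intro pos_less) simp
    then show ?thesis using assms \<open>j \<in> N\<close> by simp
  qed (simp add: \<open>j \<in> N\<close>)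
  then have "card {..j} \<le> card N" by (intro card_mono) auto
  then show "pos j \<le> card N" by (simp add: pos_def)
next
  assume j: "pos j \<le> card N"
  show "j \<in> N"
  proof (rule ccontr)
    assume "j \<notin> N"
    have "i < j" if "i \<in> N" for i
    proof (rule ccontr)
      assume "\<not> i < j"
      then have "j \<le> i" by simp
      then have "pos j \<le> pos i"
        using pos_less[of j i] by (cases "i = j") (simp_all add: order_le_less)
      then show False using assms that \<open>j \<notin> N\<close> by blast
    qed
    then have "N \<subset> {..j}" using \<open>j \<notin> N\<close> by (auto intro: less_imp_le)
    then have "card N < pos j" unfolding pos_def by (intro psubset_card_mono) auto
    with j show False by simp
  qed
qed

text \<open>The two sets are sorted separately and concatenated. Sorting the union could let
  elements of \<open>F'\<close> precede elements of \<open>F\<close> when values of \<open>g\<close>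
  tie; this way \<open>F\<close> occupies exactly the first positions.\<close>

lemma ex_sorted_enumeration:
  fixes g :: "'b \<Rightarrow> real" and F F' :: "'b set"
  assumes "finite F" "finite F'" "F \<inter> F' = {}" "card F + card F' = CARD('a)"
    and "\<And>x y. x \<in> F \<Longrightarrow> y \<in> F' \<Longrightarrow> g y \<le> g x"
  obtains v :: "'a::{finite,wellorder} \<Rightarrow> 'b" where "bij_betw v UNIV (F \<union> F')" "\<And>j. v j \<in> F \<longleftrightarrow> pos j \<le> card F"
    "\<And>i j. pos i \<le> pos j \<Longrightarrow> g (v j) \<le> g (v i)"
proof -
  obtain xs ys where xs: "set xs = F" "distinct xs" and ys: "set ys = F'" "distinct ys"
    using assms(1,2) finite_distinct_list by metis
  \<comment> \<open>\<open>sort_key\<close> is ascending; the negated key makes \<open>g\<close>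
    descend.\<close>
  define zs where "zs = sort_key (\<lambda>x. - g x) xs @ sort_key (\<lambda>x. - g x) ys"
  have zs: "distinct zs" "set zs = F \<union> F'" "sorted (map (\<lambda>x. - g x) zs)"
    using xs ys assms(3,5) by (auto simp: zs_def sorted_append)
  have lens: "length zs = CARD('a)" "length xs = card F"
    using zs(1,2) xs assms by (metis card_Un_disjoint distinct_card)+
  \<comment> \<open>Positions count from 1, list entries from 0.\<close>
  define v where "v j = zs ! (pos j - 1)" for j :: 'a
  have idx: "pos j - 1 < length zs" for j :: 'a
    using pos_bounds[of j] lens by linarith
  have "inj v"
  proof (rule injI)
    fix i j assume "v i = v j"
    then have "pos i - 1 = pos j - 1"
      using nth_eq_iff_index_eq[OF zs(1) idx idx] by (simp add: v_def)
    then show "i = j" using pos_bounds(1)[of i] pos_bounds(1)[of j] by (metis le_add_diff_inverse pos_eq_iff)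
  qed
  moreover have "range v \<subseteq> F \<union> F'"
    unfolding v_def zs(2)[symmetric] using idx by auto
  moreover have "card (range v) = card (F \<union> F')"
    using \<open>inj v\<close> assms by (simp add: card_image card_Un_disjoint)
  ultimately have "bij_betw v UNIV (F \<union> F')"
    using assms(1,2) unfolding bij_betw_def by (simp add: card_subset_eq)
  moreover have "v j \<in> F \<longleftrightarrow> pos j \<le> card F" for j
  proof (cases "pos j \<le> card F")
    case True
    then have i: "pos j - 1 < length xs" using pos_bounds(1)[of j] lens by linarith
    then have "v j = sort_key (\<lambda>x. - g x) xs ! (pos j - 1)" by (simp add: v_def zs_def nth_append)
    also have "\<dots> \<in> set (sort_key (\<lambda>x. - g x) xs)" using i by (intro nth_mem) simp
    finally show ?thesis using True xs by simp
  next
    case False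
    then have i: "\<not> pos j - 1 < length xs" using lens by linarith
    then have "v j = sort_key (\<lambda>x. - g x) ys ! (pos j - 1 - length xs)" by (simp add: v_def zs_def nth_append)
    also have "\<dots> \<in> set (sort_key (\<lambda>x. - g x) ys)"
      using i idx[of j] by (intro nth_mem) (simp add: zs_def)
    finally show ?thesis using False ys assms(3) by auto
  qed
  moreover have "g (v j) \<le> g (v i)" if "pos i \<le> pos j" for i j
    using sorted_nth_mono[OF zs(3), of "pos i - 1" "pos j - 1"] that idx by (simp add: v_def)
  ultimately show thesis using that by blast
qed

section \<open>Columns of a decomposition and its construction from right singular vectors\<close>

lemma orthonormal_columns:
  fixes V :: "real^'n^'n"
  assumes "orthogonal_matrix V"
  shows "column i V \<bullet> column j V = (if i = j then 1 else 0)"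
  using assms by (auto simp: orthogonal_matrix_orthonormal_columns orthogonal_def norm_eq_1)

lemma matrix_vector_column_sum: "M *v x = (\<Sum>k\<in>UNIV. x $ k *\<^sub>R column k M)"
  for M :: "real^'n^'m"
  by (simp add: matrix_mult_sum scalar_mult_eq_scaleR)

lemma column_matrix_mult: "column j (M ** N) = M *v column j N"
  by (simp add: vec_eq_iff column_def matrix_matrix_mult_def matrix_vector_mult_def)

lemma matrix_eq_columns: "(\<And>j. column j M = column j N) \<Longrightarrow> M = N"
  by (simp add: vec_eq_iff column_def)

text \<open>Column \<open>j\<close> of \<open>G V = U S\<close>: the only possible nonzero entry of
  column \<open>j\<close> of \<open>S\<close> is in the row with the same number, and there is no
  such row when \<open>pos j\<close> exceeds the number of rows.\<close>

lemma svd_column: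
  fixes G :: "real^'n::{finite,wellorder}^'m::{finite,wellorder}"
  assumes "is_svd G U S V"
  shows "pos i = pos j \<Longrightarrow> G *v column j V = S $ i $ j *\<^sub>R column i U"
    and "CARD('m) < pos j \<Longrightarrow> G *v column j V = 0"
proof -
  have svd: "orthogonal_matrix V" "\<And>i j. pos i \<noteq> pos j \<Longrightarrow> S $ i $ j = 0" "G = U ** S ** transpose V"
    using assms by (auto simp: is_svd_def)
  have "G ** V = U ** S ** (transpose V ** V)"
    unfolding svd(3) by (simp add: matrix_mul_assoc)
  then have "G ** V = U ** S"
    using svd(1) by (simp add: orthogonal_matrix_def)
  then have "G *v column j V = U *v column j S"
    by (metis column_matrix_mult)
  also have "\<dots> = (\<Sum>k\<in>UNIV. S $ k $ j *\<^sub>R column k U)"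
    by (subst matrix_vector_column_sum) (simp add: column_def)
  finally have eq: "G *v column j V = (\<Sum>k\<in>UNIV. S $ k $ j *\<^sub>R column k U)" .
  show "G *v column j V = S $ i $ j *\<^sub>R column i U" if "pos i = pos j"
  proof -
    have "S $ k $ j *\<^sub>R column k U = (if k = i then S $ i $ j *\<^sub>R column i U else 0)" for k
    proof (cases "k = i")
      case False
      then have "pos k \<noteq> pos j" unfolding that[symmetric] by simp
      then show ?thesis using False svd(2) by simp
    qed simp
    then have "(\<Sum>k\<in>UNIV. S $ k $ j *\<^sub>R column k U) =
        (\<Sum>k\<in>UNIV. if k = i then S $ i $ j *\<^sub>R column i U else 0)"
      by (rule sum.cong[OF refl])
    then show ?thesis unfolding eq by simp
  qed
  show "G *v column j V = 0" if "CARD('m) < pos j"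
  proof -
    have "S $ k $ j = 0" for k
      using svd(2)[of k j] pos_bounds(2)[of k] that by auto
    then show ?thesis unfolding eq by simp
  qed
qed

lemma pos_match:
  fixes j :: "'n::{finite,wellorder}"
  assumes "pos j \<le> CARD('m)"
  obtains i :: "'m::{finite,wellorder}" where "pos i = pos j"
  using pos_kth[where 'a = 'm, of "pos j"] assms pos_bounds(1)[of j] by auto

text \<open>Passes from the entries of \<open>S\<close> to the images of the right singular vectors,
  so that later arguments need not match row and column numbers of a rectangular matrix.\<close>

lemma svd_images:
  fixes G :: "real^'n::{finite,wellorder}^'m::{finite,wellorder}"
  assumes "is_svd G U S V"
  shows "j \<noteq> j' \<Longrightarrow> (G *v column j V) \<bullet> (G *v column j' V) = 0"
    and "pos j \<le> pos j' \<Longrightarrow> norm (G *v column j' V) \<le> norm (G *v column j V)"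
proof -
  have U: "orthogonal_matrix U"
    and S: "\<And>i j. pos i = pos j \<Longrightarrow> 0 \<le> S $ i $ j"
      "\<And>i j i' j'. pos i = pos j \<Longrightarrow> pos i' = pos j' \<Longrightarrow> pos i \<le> pos i' \<Longrightarrow> S $ i' $ j' \<le> S $ i $ j"
    using assms by (auto simp: is_svd_def)
  note col = svd_column[OF assms]
  show "(G *v column j V) \<bullet> (G *v column j' V) = 0" if "j \<noteq> j'"
  proof (cases "pos j \<le> CARD('m) \<and> pos j' \<le> CARD('m)")
    case True
    then obtain i i' :: 'm where i: "pos i = pos j" "pos i' = pos j'"
      using pos_match by metis
    moreover from i have "i \<noteq> i'" using that by auto
    ultimately show ?thesis by (simp add: col(1)[OF i(1)] col(1)[OF i(2)] orthonormal_columns[OF U])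
  next
    case False
    then show ?thesis using col(2)[of j] col(2)[of j'] by auto
  qed
  show "norm (G *v column j' V) \<le> norm (G *v column j V)" if le: "pos j \<le> pos j'"
  proof (cases "pos j' \<le> CARD('m)")
    case True
    obtain i :: 'm where i: "pos i = pos j"
      by (rule pos_match[OF le_trans[OF le True]]) blast
    obtain i' :: 'm where i': "pos i' = pos j'"
      by (rule pos_match[OF True]) blast
    have "norm (column k U) = 1" for k
      by (simp add: norm_eq_1 orthonormal_columns[OF U])
    then show ?thesis
      using S(1)[OF i] S(1)[OF i'] S(2)[OF i i'] le i i'
      by (simp add: col(1)[OF i] col(1)[OF i'])
  next
    case False
    then show ?thesis using col(2)[of j'] by simp
  qed
qed

text \<open>The normalized nonzero images serve as left singular vectors and are completed
  arbitrarily to an orthonormal basis; the norms are the singular values. The last conclusion ties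
  the columns of \<open>U\<close> to the prescribed vectors.\<close>

lemma ex_svd_of_basis:
  fixes G :: "real^'n::{finite,wellorder}^'m::{finite,wellorder}" and v :: "'n \<Rightarrow> real^'n::_"
  assumes orth: "\<And>i j. v i \<bullet> v j = (if i = j then 1 else 0)"
    and Gorth: "\<And>i j. i \<noteq> j \<Longrightarrow> (G *v v i) \<bullet> (G *v v j) = 0"
    and mono: "\<And>i j. pos i \<le> pos j \<Longrightarrow> norm (G *v v j) \<le> norm (G *v v i)"
  obtains U S V where "is_svd G U S V" "\<And>j. column j V = v j"
    "\<And>i j. pos i = pos j \<Longrightarrow> G *v v j = norm (G *v v j) *\<^sub>R column i U"
proof -
  define N where "N = {j. G *v v j \<noteq> 0}"
  define h where "h j = (G *v v j) /\<^sub>R norm (G *v v j)" for j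
  \<comment> \<open>As the norms do not increase, the nonzero images come first, so the columns in
    \<open>N\<close> and the rows in \<open>M\<close> carry the same numbers.\<close>
  have N: "j \<in> N \<longleftrightarrow> pos j \<le> card N" for j
  proof (rule down_closed_pos)
    fix i j :: 'n assume "j \<in> N" "pos i \<le> pos j"
    then show "i \<in> N"
      using mono[of i j] by (auto simp: N_def)
  qed
  have hh: "h i \<bullet> h j = (if i = j then 1 else 0)" if "i \<in> N" "j \<in> N" for i j
    using that Gorth[of i j] by (auto simp: h_def N_def dot_square_norm power2_eq_square field_simps)
  have "inj_on h N"
  proof (rule inj_onI)
    fix i j assume "i \<in> N" "j \<in> N" "h i = h j"
    then show "i = j" using hh[of i j] hh[of i i] by (simp split: if_splits)
  qed
  have D: "orthonormal (h ` N)"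
    using hh by (auto simp: orthonormal_def pairwise_def orthogonal_def norm_eq_1)
  have cD: "card (h ` N) = card N"
    using \<open>inj_on h N\<close> by (rule card_image)
  have cN: "card N \<le> CARD('m)"
    using orthonormal_card[OF D] dim_subset_UNIV[of "span (h ` N)"] cD by simp
  obtain F where F: "orthonormal F" "orthonormal (h ` N \<union> F)" "h ` N \<inter> F = {}"
    "span (h ` N \<union> F) = UNIV" "\<And>x y. x \<in> span (h ` N) \<Longrightarrow> y \<in> F \<Longrightarrow> x \<bullet> y = 0"
    by (rule ex_orthogonal_complement_basis[OF D]) blast
  define M where "M = {i :: 'm. pos i \<le> card N}"
  have "card N + card F = CARD('m)"
    using orthonormal_card_UNIV[OF F(2,4)] F(3) cD orthonormal_finite[OF F(1)]
    by (simp add: card_Un_disjoint)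
  moreover have "card M + card (- M) = CARD('m)"
    using card_Un_disjoint[of M "- M"] by simp
  moreover have "card M = card N"
    unfolding M_def by (rule card_pos_le[OF cN])
  ultimately have "card (- M) = card F" by linarith
  then obtain q where q: "bij_betw q (- M) F"
    using finite_same_card_bij orthonormal_finite[OF F(1)] finite by metis
  \<comment> \<open>\<open>kth UNIV (pos i)\<close> is the column index with the number of row
    \<open>i\<close>; for \<open>i\<close> in \<open>M\<close> it exists and lies in
    \<open>N\<close>.\<close>
  define u where "u i = (if i \<in> M then h (kth UNIV (pos i)) else q i)" for i :: 'm
  have kN: "pos (kth UNIV (pos i) :: 'n) = pos i" "kth UNIV (pos i) \<in> N" if "i \<in> M" for i :: 'm
  proof -
    have "card N \<le> CARD('n)" by (rule card_mono) auto
    then show "pos (kth UNIV (pos i) :: 'n) = pos i"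
      using that pos_bounds(1)[of i] by (intro pos_kth) (simp add: M_def)
    then show "kth UNIV (pos i) \<in> N"
      using that by (simp add: N M_def)
  qed
  have u_mem: "u i \<in> h ` N \<union> F" for i
    using kN(2) q by (auto simp: u_def bij_betw_def)
  have "inj u"
  proof (rule injI)
    fix i i' assume eq: "u i = u i'"
    have sep: "i \<in> M \<longleftrightarrow> i' \<in> M"
      using eq F(3) kN(2) q unfolding u_def bij_betw_def
      by (metis (no_types, lifting) ComplI disjoint_iff imageI)
    show "i = i'"
    proof (cases "i \<in> M")
      case True
      then have "(kth UNIV (pos i) :: 'n) = kth UNIV (pos i')"
        using eq sep kN(2) \<open>inj_on h N\<close> by (simp add: u_def inj_on_eq_iff)
      then show ?thesis using kN(1) True sep by (metis pos_eq_iff)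
    next
      case False
      then show ?thesis
        using eq sep q by (auto simp: u_def bij_betw_def inj_on_eq_iff)
    qed
  qed
  have uu: "u i \<bullet> u j = (if i = j then 1 else 0)" for i j
    using orthonormal_inner[OF F(2) u_mem u_mem] \<open>inj u\<close> by (simp add: inj_eq)
  define U where "U = (\<chi> i k. u k $ i)"
  define V where "V = (\<chi> i k. v k $ i)"
  define S :: "real^'n::_^'m::_" where "S = (\<chi> i j. if pos i = pos j then norm (G *v v j) else 0)"
  have cU: "column k U = u k" and cV: "column j V = v j" for k j
    by (simp_all add: U_def V_def column_def)
  have match: "G *v v j = norm (G *v v j) *\<^sub>R u i" if "pos i = pos j" for i j
  proof (cases "j \<in> N")
    case True
    then have "i \<in> M" using that by (simp add: N M_def)
    then have "u i = h j" using kth_pos[of j "pos i"] that by (simp add: u_def)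
    then show ?thesis using True by (simp add: h_def N_def)
  qed (simp add: N_def)
  have "orthogonal_matrix U" "orthogonal_matrix V"
    using uu orth by (auto simp: orthogonal_matrix_orthonormal_columns cU cV norm_eq_1 orthogonal_def)
  moreover have "G = U ** S ** transpose V"
  proof -
    have "G ** V = U ** S"
    proof (rule matrix_eq_columns)
      fix j
      have "column j (U ** S) = (\<Sum>k\<in>UNIV. S $ k $ j *\<^sub>R u k)"
        by (simp add: column_matrix_mult matrix_vector_column_sum[of U] cU) (simp add: column_def)
      also have "\<dots> = G *v v j"
      proof (cases "pos j \<le> CARD('m)")
        case True
        then obtain i :: 'm where i: "pos i = pos j" using pos_match by blast
        have "S $ k $ j *\<^sub>R u k = (if k = i then norm (G *v v j) *\<^sub>R u i else 0)" for k
        proof (cases "k = i")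
          case False
          then have "pos k \<noteq> pos j" unfolding i[symmetric] by simp
          then show ?thesis using False by (simp add: S_def)
        qed (simp add: S_def i)
        then have "(\<Sum>k\<in>UNIV. S $ k $ j *\<^sub>R u k) = norm (G *v v j) *\<^sub>R u i"
          by simp
        then show ?thesis
          unfolding match[OF i, symmetric] .
      next
        \<comment> \<open>A column without matching row has number above \<open>card N\<close>, so
          its image is zero.\<close>
        case False
        then have "S $ k $ j = 0" for k using pos_bounds(2)[of k] by (auto simp: S_def)
        moreover have "j \<notin> N" using False cN by (simp add: N)
        ultimately show ?thesis by (simp add: N_def)
      qed
      finally show "column j (G ** V) = column j (U ** S)"
        by (simp add: column_matrix_mult cV)
    qed
    then have "U ** S ** transpose V = G ** (V ** transpose V)"
      by (simp add: matrix_mul_assoc)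
    then show ?thesis
      using \<open>orthogonal_matrix V\<close> by (simp add: orthogonal_matrix_def)
  qed
  ultimately have "is_svd G U S V"
    using mono by (auto simp: is_svd_def S_def)
  then show thesis
  proof (rule that)
    show "G *v v j = norm (G *v v j) *\<^sub>R column i U" if "pos i = pos j" for i j
      unfolding cU using that by (rule match)
  qed (rule cV)
qed

subsection \<open>Minimizers of the adapter objective\<close>

text \<open>Composite of two enumerations: a column number of the submatrix selects an element of
  \<open>I\<close>, which in turn names an index of the full matrix.\<close>

lemma bij_betw_cols_index:
  assumes "I \<subseteq> {1..CARD('k::{finite,wellorder})}" "card I = CARD('r)"
  shows "bij_betw (\<lambda>j :: 'r::{finite,wellorder}. kth UNIV (kth I (pos j)) :: 'k) UNIV {i. pos i \<in> I}"
proof -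
  have fin: "finite I" using assms(1) by (rule finite_subset) simp
  have "bij_betw (\<lambda>j :: 'r. pos j - 1) UNIV {..<CARD('r)}"
  proof -
    have "bij_betw (\<lambda>k. k - 1) {1..CARD('r)} {..<CARD('r)}"
      by (rule bij_betw_byWitness[where f' = Suc]) auto
    from bij_betw_trans[OF bij_betw_pos this] show ?thesis by (simp add: o_def)
  qed
  moreover have "bij_betw (enumerate I) {..<CARD('r)} I"
    using finite_bij_enumerate[OF fin] assms(2) by simp
  ultimately have 1: "bij_betw (\<lambda>j :: 'r. kth I (pos j)) UNIV I"
    using bij_betw_trans by (fastforce simp: kth_def o_def)
  have "bij_betw (kth UNIV) I {i :: 'k. pos i \<in> I}"
  proof (rule bij_betw_byWitness[where f' = pos])
    show "\<forall>k\<in>I. pos (kth UNIV k :: 'k) = k"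
      using assms(1) by (blast intro: pos_kth)
    then show "kth UNIV ` I \<subseteq> {i :: 'k. pos i \<in> I}" by auto
  qed (auto simp: kth_pos)
  from bij_betw_trans[OF 1 this] show ?thesis by (simp add: o_def)
qed

lemma column_cols: "column j (cols M I) = column (kth UNIV (kth I (pos j))) M"
  by (simp add: column_def cols_def)

lemma cols_orthonormal:
  fixes U :: "real^'k::{finite,wellorder}^'k::_"
  assumes "orthogonal_matrix U" "I \<subseteq> {1..CARD('k)}" "card I = CARD('r)"
  shows "transpose (cols U I) ** (cols U I :: real^'r::{finite,wellorder}^'k::_) = mat 1"
proof -
  have inj: "inj (\<lambda>j :: 'r. kth UNIV (kth I (pos j)) :: 'k)"
    using bij_betw_cols_index[OF assms(2,3)] by (rule bij_betw_imp_inj_on)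
  show ?thesis
    by (simp add: vec_eq_iff mat_def matrix_mult_transpose_dot_column column_cols
        orthonormal_columns[OF assms(1)] inj_eq[OF inj])
qed

text \<open>For \<open>W = cols U I\<close>, the matrix \<open>W W^T\<close> is the orthogonal
  projection onto the span of the selected columns, evaluated here on the basis of all
  columns.\<close>

lemma cols_projection:
  fixes U :: "real^'k::{finite,wellorder}^'k::_"
  assumes "orthogonal_matrix U" "I \<subseteq> {1..CARD('k)}" "card I = CARD('r)"
  shows "(cols U I :: real^'r::{finite,wellorder}^'k::_) *v
      (transpose (cols U I :: real^'r::_^'k::_) *v column i U) =
    (if pos i \<in> I then column i U else 0)"
proof -
  let ?W = "cols U I :: real^'r::_^'k::_" and ?s = "\<lambda>j :: 'r. kth UNIV (kth I (pos j)) :: 'k"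
  have coeff: "(transpose ?W *v x) $ j = column (?s j) U \<bullet> x" for x j
    by (simp add: matrix_mult_dot transpose_def column_def cols_def)
  have "?W *v (transpose ?W *v column i U) = (\<Sum>j\<in>UNIV. (column (?s j) U \<bullet> column i U) *\<^sub>R column (?s j) U)"
    by (simp add: matrix_vector_column_sum[of ?W] coeff column_cols)
  also have "\<dots> = (\<Sum>k | pos k \<in> I. (column k U \<bullet> column i U) *\<^sub>R column k U)"
    using bij_betw_cols_index[OF assms(2,3)] by (rule sum.reindex_bij_betw)
  also have "\<dots> = (\<Sum>k | pos k \<in> I. if k = i then column i U else 0)"
    by (intro sum.cong) (auto simp: orthonormal_columns[OF assms(1)])
  also have "\<dots> = (if pos i \<in> I then column i U else 0)"
    by simp
  finally show ?thesis .
qed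

text \<open>\<open>P P^T\<close> cancels: an adapter enters the residual only through its Gram
  matrix, whence the freedom of an orthogonal factor.\<close>

lemma gram_mult_orthogonal:
  fixes W :: "real^'r^'k" and P :: "real^'r^'r"
  assumes "orthogonal_matrix P"
  shows "(W ** P) *v (transpose (W ** P) *v x) = W *v (transpose W *v x)"
proof -
  have "(W ** P) ** transpose (W ** P) = W ** (P ** transpose P) ** transpose W"
    by (simp add: matrix_transpose_mul matrix_mul_assoc)
  then show ?thesis
    using assms by (simp add: matrix_vector_mul_assoc orthogonal_matrix_def)
qed

text \<open>With \<open>P = A^T W\<close> the second hypothesis reads \<open>A P = W\<close>, so
  \<open>P^T P = W^T A A^T W = W^T W\<close> is the identity. As \<open>P\<close> is square it is
  orthogonal, and \<open>A = W P^T\<close>.\<close>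

lemma ex_orthogonal_factor:
  fixes A W :: "real^'r^'k"
  assumes "transpose W ** W = mat 1" "\<And>j. A *v (transpose A *v column j W) = column j W"
  obtains P where "orthogonal_matrix P" "A = W ** P"
proof -
  have AW: "A ** (transpose A ** W) = W"
    by (rule matrix_eq_columns) (simp add: column_matrix_mult assms(2))
  define P where "P = transpose A ** W"
  have "transpose P ** P = transpose W ** (A ** (transpose A ** W))"
    by (simp add: P_def matrix_transpose_mul matrix_mul_assoc)
  then have P: "orthogonal_matrix P"
    using AW assms(1) by (simp add: orthogonal_matrix)
  have "W ** transpose P = A ** (P ** transpose P)"
    using AW by (simp add: P_def[symmetric] matrix_mul_assoc)
  then have "A = W ** transpose P"
    using P by (simp add: orthogonal_matrix_def)
  then show thesis using that[of "transpose P"] P by simp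
qed

section \<open>Removal of the scaling factor\<close>

lemma scaleR_matrix_mult:
  fixes M :: "real^'n^'m" and N :: "real^'k^'n"
  shows "(c *\<^sub>R M) ** N = c *\<^sub>R (M ** N)" "M ** (c *\<^sub>R N) = c *\<^sub>R (M ** N)"
  by (simp_all add: vec_eq_iff matrix_matrix_mult_def sum_distrib_left mult_ac)

lemma transpose_scaleR: "transpose (c *\<^sub>R M) = c *\<^sub>R transpose M" for M :: "real^'n^'m"
  by (simp add: vec_eq_iff transpose_def)

lemma adapter_objective_scaled:
  fixes G :: "real^'n^'m" and A :: "real^'r^'m" and B :: "real^'r^'n"
  assumes "L > 0" "\<eta> > 0"
  shows "adapter_objective L \<eta> G ((1 / sqrt (L * \<eta>)) *\<^sub>R A) ((1 / sqrt (L * \<eta>)) *\<^sub>R B) =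
    1 / (2 * L) * (norm (residual G A B))\<^sup>2"
proof -
  define c where "c = 1 / sqrt (L * \<eta>)"
  have c: "c * c = 1 / (L * \<eta>)"
    using assms by (simp add: c_def)
  have "(1 / L) *\<^sub>R G - \<eta> *\<^sub>R (G ** (c *\<^sub>R B) ** transpose (c *\<^sub>R B))
      - \<eta> *\<^sub>R ((c *\<^sub>R A) ** transpose (c *\<^sub>R A) ** G) =
    (1 / L) *\<^sub>R G - (\<eta> * (c * c)) *\<^sub>R (G ** B ** transpose B) - (\<eta> * (c * c)) *\<^sub>R (A ** transpose A ** G)"
    by (simp add: scaleR_matrix_mult transpose_scaleR mult_ac)
  also have "\<dots> = (1 / L) *\<^sub>R residual G A B"
    using assms by (simp add: c residual_def scaleR_diff_right)
  finally have "adapter_objective L \<eta> G (c *\<^sub>R A) (c *\<^sub>R B) = L / 2 * (norm ((1 / L) *\<^sub>R residual G A B))\<^sup>2"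
    by (simp add: adapter_objective_def)
  also have "\<dots> = 1 / (2 * L) * (norm (residual G A B))\<^sup>2"
    using assms by (simp add: power_mult_distrib power2_eq_square)
  finally show ?thesis by (simp add: c_def)
qed

text \<open>For \<open>V\<close> from a singular value decomposition, the sum of the
  \<open>k\<close> largest squared singular values, written without reference to the rectangular
  \<open>S\<close>.\<close>

definition top_energy :: "real^'n::{finite,wellorder}^'m \<Rightarrow> real^'n::_^'n::_ \<Rightarrow> nat \<Rightarrow> real" where
  "top_energy G V k = (\<Sum>j | pos j \<le> k. (norm (G *v column j V))\<^sup>2)"

lemma orthogonal_matrix_column_basis:
  fixes V :: "real^'n^'n"
  assumes "orthogonal_matrix V"
  shows "inj (\<lambda>j. column j V)" "orthonormal (range (\<lambda>j. column j V))"
    "span (range (\<lambda>j. column j V)) = UNIV"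
proof -
  note o = orthonormal_columns[OF assms]
  show inj: "inj (\<lambda>j. column j V)"
  proof (rule injI)
    fix i j assume "column i V = column j V"
    then show "i = j" using o[of i i] o[of i j] by (simp split: if_splits)
  qed
  show orth: "orthonormal (range (\<lambda>j. column j V))"
    by (auto simp: orthonormal_def pairwise_def orthogonal_def norm_eq_1 o)
  show "span (range (\<lambda>j. column j V)) = UNIV"
    using inj by (intro orthonormal_span_UNIV[OF orth]) (simp add: card_image)
qed

lemma svd_ky_fan:
  fixes G :: "real^'n::{finite,wellorder}^'m::{finite,wellorder}"
  assumes svd: "is_svd G U S V" and "k \<le> CARD('n)" "orthonormal E" "card E = k"
  shows "(\<Sum>e\<in>E. (norm (G *v e))\<^sup>2) \<le> top_energy G V k"
proof -
  let ?v = "\<lambda>j. column j V"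
  have "orthogonal_matrix V" using svd by (simp add: is_svd_def)
  note basis = orthogonal_matrix_column_basis[OF this]
  have injF: "inj_on ?v {j. pos j \<le> k}"
    using basis(1) by (rule inj_on_subset) simp
  have "(\<Sum>e\<in>E. (norm (G *v e))\<^sup>2) \<le> (\<Sum>b\<in>?v ` {j. pos j \<le> k}. (norm (G *v b))\<^sup>2)"
  proof (rule ky_fan[OF _ basis(2,3)])
    show "linear ((*v) G)" by simp
    show "pairwise (\<lambda>x y. (G *v x) \<bullet> (G *v y) = 0) (range ?v)"
      by (auto simp: pairwise_def intro!: svd_images(1)[OF svd])
    show "card E = card (?v ` {j. pos j \<le> k})"
      using assms(4) card_pos_le[OF assms(2)] card_image[OF injF] by simp
    fix x y assume x: "x \<in> ?v ` {j. pos j \<le> k}" and y: "y \<in> range ?v - ?v ` {j. pos j \<le> k}"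
    then obtain i j where "x = ?v i" "pos i \<le> k" "y = ?v j" by auto
    moreover from this y have "\<not> pos j \<le> k" by auto
    ultimately show "norm (G *v y) \<le> norm (G *v x)"
      using svd_images(2)[OF svd, of i j] by simp
  qed (use assms in auto)
  also have "\<dots> = top_energy G V k"
    unfolding top_energy_def using injF by (simp add: sum.reindex)
  finally show ?thesis .
qed

lemma index_sets_subset:
  fixes I J :: "nat set"
  assumes "I \<union> J = {1..k}" "k \<le> m" "k \<le> n"
  shows "I \<subseteq> {1..m}" "J \<subseteq> {1..n}"
proof -
  have "I \<subseteq> {1..k}" "J \<subseteq> {1..k}"
    using assms(1) by blast+
  moreover have "{1..k} \<subseteq> {1..m}" "{1..k} \<subseteq> {1..n}"
    using assms(2,3) by auto
  ultimately show "I \<subseteq> {1..m}" "J \<subseteq> {1..n}"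
    by blast+
qed

text \<open>Each of the first \<open>2r\<close> right singular vectors is handled by exactly one
  adapter, so the residual vanishes there; on the remaining ones it equals \<open>G\<close>.\<close>

lemma residual_svd:
  fixes G :: "real^'n::{finite,wellorder}^'m::{finite,wellorder}"
    and P Q :: "real^'r::{finite,wellorder}^'r::_"
  assumes svd: "is_svd G U S V" and dims: "2 * CARD('r) \<le> CARD('m)" "2 * CARD('r) \<le> CARD('n)"
    and IJ: "I \<union> J = {1..2 * CARD('r)}" "card I = CARD('r)" "card J = CARD('r)"
    and PQ: "orthogonal_matrix P" "orthogonal_matrix Q"
  shows "(norm (residual G (cols U I ** P) (cols V J ** Q)))\<^sup>2 =
    (norm G)\<^sup>2 - top_energy G V (2 * CARD('r))"
proof -
  let ?R = "residual G (cols U I ** P) (cols V J ** Q)"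
  have UV: "orthogonal_matrix U" "orthogonal_matrix V" using svd by (auto simp: is_svd_def)
  note basis = orthogonal_matrix_column_basis[OF UV(2)]
  have sub: "I \<subseteq> {1..CARD('m)}" "J \<subseteq> {1..CARD('n)}"
    by (rule index_sets_subset[OF IJ(1) dims])+
  have fin: "finite I" "finite J"
    using sub finite_subset by blast+
  \<comment> \<open>The union has \<open>2r\<close> elements and the sets have \<open>r\<close>
    each, so they cannot overlap.\<close>
  have "card (I \<union> J) + card (I \<inter> J) = card I + card J"
    using card_Un_Int[OF fin] by simp
  then have disj: "I \<inter> J = {}"
    using IJ fin by simp
  have R: "?R *v column j V = (if pos j \<le> 2 * CARD('r) then 0 else G *v column j V)" for j
  proof -
    have B: "(cols V J ** Q) *v (transpose (cols V J ** Q) *v column j V) =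
        (if pos j \<in> J then column j V else 0)"
      unfolding gram_mult_orthogonal[OF PQ(2)] by (rule cols_projection[OF UV(2) sub(2) IJ(3)])
    have A: "(cols U I ** P) *v (transpose (cols U I ** P) *v (G *v column j V)) =
        (if pos j \<in> I then G *v column j V else 0)"
    proof (cases "pos j \<le> CARD('m)")
      case True
      then obtain i :: 'm where i: "pos i = pos j" using pos_match by blast
      show ?thesis
        unfolding gram_mult_orthogonal[OF PQ(1)] svd_column(1)[OF svd i] matrix_vector_mult_scaleR
          cols_projection[OF UV(1) sub(1) IJ(2)] i by simp
    next
      case False
      then show ?thesis using svd_column(2)[OF svd, of j] by simp
    qed
    have "pos j \<le> 2 * CARD('r) \<longleftrightarrow> pos j \<in> I \<union> J"
      using IJ(1) pos_bounds(1)[of j] by simp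
    then show ?thesis
      using disj unfolding residual_apply A B by auto
  qed
  have sum: "(norm N)\<^sup>2 = (\<Sum>j\<in>UNIV. (norm (N *v column j V))\<^sup>2)" for N :: "real^'n::_^'m::_"
    using norm_sq_matrix_orthonormal[OF basis(2,3), of N] basis(1) by (simp add: sum.reindex)
  have "(norm G)\<^sup>2 - top_energy G V (2 * CARD('r)) =
      (\<Sum>j\<in>UNIV - {j. pos j \<le> 2 * CARD('r)}. (norm (G *v column j V))\<^sup>2)"
    unfolding top_energy_def sum[of G] by (subst sum_diff) auto
  also have "\<dots> = (\<Sum>j\<in>UNIV. (norm (?R *v column j V))\<^sup>2)"
    unfolding R by (rule sum.mono_neutral_cong_left) auto
  finally show ?thesis using sum[of ?R] by simp
qed

lemma ex_svd:
  fixes G :: "real^'n::{finite,wellorder}^'m::{finite,wellorder}"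
  obtains U S V where "is_svd G U S V"
proof -
  obtain E where E: "orthonormal E" "span E = UNIV" "pairwise (\<lambda>x y. (G *v x) \<bullet> (G *v y) = 0) E"
    using ex_orthonormal_diagonal[of "(*v) G" UNIV] by auto
  have cardE: "card E + card ({} :: (real^'n::_) set) = CARD('n)"
    using orthonormal_card_UNIV[OF E(1,2)] by simp
  obtain v :: "'n \<Rightarrow> real^'n::_" where v: "bij_betw v UNIV (E \<union> {})" "\<And>j. v j \<in> E \<longleftrightarrow> pos j \<le> card E"
    "\<And>i j. pos i \<le> pos j \<Longrightarrow> norm (G *v v j) \<le> norm (G *v v i)"
    by (rule ex_sorted_enumeration[OF orthonormal_finite[OF E(1)] _ _ cardE, of "\<lambda>x. norm (G *v x)"]) auto
  have inj: "inj v" and mem: "v j \<in> E" for j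
    using v(1) by (auto simp: bij_betw_def)
  have vv: "v i \<bullet> v j = (if i = j then 1 else 0)" for i j
    using orthonormal_inner[OF E(1) mem mem] inj by (simp add: inj_eq)
  have Gv: "(G *v v i) \<bullet> (G *v v j) = 0" if "i \<noteq> j" for i j
    using E(3) mem inj that by (simp add: pairwise_def inj_eq)
  show thesis
    by (rule ex_svd_of_basis[OF vv Gv v(3)]) (assumption | erule that)+
qed

text \<open>The decomposition is built from the minimizer itself, with the bases of
  \<open>residual_minimal_structure\<close> as right singular vectors.\<close>

lemma adapter_characterization:
  fixes G :: "real^'n::{finite,wellorder}^'m::{finite,wellorder}"
    and A :: "real^'r::{finite,wellorder}^'m::_" and B :: "real^'r::_^'n::_"
  assumes rank: "2 * CARD('r) \<le> rank G"
    and min: "\<And>(A' :: real^'r::_^'m::_) (B' :: real^'r::_^'n::_). norm (residual G A B) \<le> norm (residual G A' B')"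
  obtains U S V I J and P Q :: "real^'r::_^'r::_" where "is_svd G U S V" "I \<union> J = {1..2 * CARD('r)}"
    "card I = CARD('r)" "card J = CARD('r)" "orthogonal_matrix P" "orthogonal_matrix Q"
    "A = cols U I ** P" "B = cols V J ** Q"
proof -
  let ?r = "CARD('r)"
  have dims: "2 * ?r \<le> CARD('m)" "2 * ?r \<le> CARD('n)"
    using rank rank_bound[of G] by auto
  \<comment> \<open>An auxiliary decomposition, which supplies the optimal value \<open>?K\<close>
    and the competitor \<open>?A\<close>, \<open>?B\<close> attaining it.\<close>
  obtain U0 S0 V0 where svd0: "is_svd G U0 S0 V0" by (rule ex_svd)
  let ?K = "top_energy G V0 (2 * ?r)"
  let ?A = "cols U0 {1..?r} ** (mat 1 :: real^'r::_^'r::_)"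
    and ?B = "cols V0 {Suc ?r..2 * ?r} ** (mat 1 :: real^'r::_^'r::_)"
  have "(norm (residual G ?A ?B))\<^sup>2
      = (norm G)\<^sup>2 - ?K"
    by (rule residual_svd[OF svd0 dims]) (auto simp: orthogonal_matrix_id)
  moreover have "(norm (residual G A B))\<^sup>2 \<le>
      (norm (residual G ?A ?B))\<^sup>2"
    by (intro power_mono min) simp
  ultimately have le: "(norm (residual G A B))\<^sup>2 \<le> (norm G)\<^sup>2 - ?K" by simp
  obtain E1 E2 E3 where E: "orthonormal (E1 \<union> E2 \<union> E3)" "span (E1 \<union> E2 \<union> E3) = UNIV"
    "card E1 = ?r" "card E2 = ?r" "E1 \<inter> E2 = {}" "(E1 \<union> E2) \<inter> E3 = {}"
    "pairwise (\<lambda>x y. (G *v x) \<bullet> (G *v y) = 0) (E1 \<union> E2 \<union> E3)"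
    "\<And>x. x \<in> E1 \<Longrightarrow> B *v (transpose B *v x) = x"
    "\<And>x. x \<in> E2 \<Longrightarrow> A *v (transpose A *v (G *v x)) = G *v x"
    "\<And>x. x \<in> E1 \<union> E2 \<Longrightarrow> G *v x \<noteq> 0"
    "\<And>x y. x \<in> E1 \<union> E2 \<Longrightarrow> y \<in> E3 \<Longrightarrow> norm (G *v y) \<le> norm (G *v x)"
    by (rule residual_minimal_structure[OF rank svd_ky_fan[OF svd0 dims(2)] le]) (assumption | blast)+
  have fin: "finite (E1 \<union> E2)" "finite E3" "finite E1" "finite E2"
    using orthonormal_finite[OF E(1)] by auto
  have card12: "card (E1 \<union> E2) = 2 * ?r"
    using E(3-5) fin by (simp add: card_Un_disjoint)
  have cards: "card (E1 \<union> E2) + card E3 = CARD('n)"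
    using orthonormal_card_UNIV[OF E(1,2)] card_Un_disjoint[OF fin(1,2) E(6)] by simp
  \<comment> \<open>\<open>E1\<close> and \<open>E2\<close> form the first block and therefore
    receive the numbers 1 to \<open>2r\<close>.\<close>
  obtain v :: "'n \<Rightarrow> real^'n::_" where v: "bij_betw v UNIV (E1 \<union> E2 \<union> E3)"
    "\<And>j. v j \<in> E1 \<union> E2 \<longleftrightarrow> pos j \<le> card (E1 \<union> E2)"
    "\<And>i j. pos i \<le> pos j \<Longrightarrow> norm (G *v v j) \<le> norm (G *v v i)"
    by (rule ex_sorted_enumeration[OF fin(1,2) E(6) cards, of "\<lambda>x. norm (G *v x)"])
      (use E(11) in blast)+
  have inj: "inj v" and mem: "v j \<in> E1 \<union> E2 \<union> E3" for j
    using v(1) by (auto simp: bij_betw_def)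
  have vv: "v i \<bullet> v j = (if i = j then 1 else 0)" for i j
    using orthonormal_inner[OF E(1) mem mem] inj by (simp add: inj_eq)
  have Gv: "(G *v v i) \<bullet> (G *v v j) = 0" if "i \<noteq> j" for i j
    using E(7) mem[of i] mem[of j] inj that unfolding pairwise_def by (simp add: inj_eq)
  obtain U S V where svd: "is_svd G U S V" "\<And>j. column j V = v j"
    "\<And>i j. pos i = pos j \<Longrightarrow> G *v v j = norm (G *v v j) *\<^sub>R column i U"
    by (rule ex_svd_of_basis[OF vv Gv v(3)]) blast+
  have UV: "orthogonal_matrix U" "orthogonal_matrix V" using svd(1) by (auto simp: is_svd_def)
  \<comment> \<open>\<open>A\<close> handles the directions in \<open>E2\<close> and
    \<open>B\<close> those in \<open>E1\<close>, hence the crossed indices.\<close>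
  define I where "I = pos ` {j. v j \<in> E2}"
  define J where "J = pos ` {j. v j \<in> E1}"
  have card_vimage: "card (pos ` {j. v j \<in> E}) = card E" if "E \<subseteq> E1 \<union> E2 \<union> E3" for E
  proof -
    have "v ` {j. v j \<in> E} = E"
      using v(1) that by (auto simp: bij_betw_def)
    then show ?thesis
      by (metis card_image inj inj_on_subset inj_pos subset_UNIV)
  qed
  have cI: "card I = ?r" and cJ: "card J = ?r"
    using card_vimage[of E1] card_vimage[of E2] E(3,4) by (auto simp: I_def J_def)
  have "I \<union> J = pos ` {j :: 'n. pos j \<le> 2 * ?r}"
    unfolding I_def J_def using v(2) card12 by auto
  also have "{j :: 'n. pos j \<le> 2 * ?r} = {j. pos j \<in> {1..2 * ?r}}"
    using pos_bounds(1) by auto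
  also have "pos ` \<dots> = {1..2 * ?r}"
    using dims(2) by (intro pos_image) auto
  finally have IJ: "I \<union> J = {1..2 * ?r}" .
  have sub: "I \<subseteq> {1..CARD('m)}" "J \<subseteq> {1..CARD('n)}"
    by (rule index_sets_subset[OF IJ dims])+
  have "B *v (transpose B *v column j (cols V J :: real^'r::_^'n::_)) = column j (cols V J :: real^'r::_^'n::_)" for j
  proof -
    let ?k = "kth UNIV (kth J (pos j)) :: 'n"
    have "pos ?k \<in> J"
      using bij_betw_cols_index[OF sub(2) cJ] by (auto simp: bij_betw_def)
    then have "v ?k \<in> E1"
      by (auto simp: J_def)
    then show ?thesis
      using E(8) by (simp add: column_cols svd(2))
  qed
  then obtain Q :: "real^'r::_^'r::_" where Q: "orthogonal_matrix Q" "B = cols V J ** Q"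
    by (rule ex_orthogonal_factor[OF cols_orthonormal[OF UV(2) sub(2) cJ]])
  have "A *v (transpose A *v column j (cols U I :: real^'r::_^'m::_)) = column j (cols U I :: real^'r::_^'m::_)" for j
  proof -
    let ?i = "kth UNIV (kth I (pos j)) :: 'm"
    have "pos ?i \<in> I"
      using bij_betw_cols_index[OF sub(1) cI] by (auto simp: bij_betw_def)
    then obtain k where k: "v k \<in> E2" "pos ?i = pos k"
      by (auto simp: I_def)
    \<comment> \<open>\<open>A A^T\<close> fixes \<open>G v_k\<close>, a multiple of the left
      singular vector; a nonzero singular value lets the factor be cancelled.\<close>
    have nz: "norm (G *v v k) \<noteq> 0"
      using E(10) k(1) by simp
    have "norm (G *v v k) *\<^sub>R (A *v (transpose A *v column ?i U)) =
        A *v (transpose A *v (norm (G *v v k) *\<^sub>R column ?i U))"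
      by (simp only: matrix_vector_mult_scaleR)
    also have "\<dots> = norm (G *v v k) *\<^sub>R column ?i U"
      unfolding svd(3)[OF k(2), symmetric] by (rule E(9)[OF k(1)])
    finally show ?thesis
      using nz by (simp add: column_cols)
  qed
  then obtain P :: "real^'r::_^'r::_" where P: "orthogonal_matrix P" "A = cols U I ** P"
    by (rule ex_orthogonal_factor[OF cols_orthonormal[OF UV(1) sub(1) cI]])
  show thesis
    by (rule that[OF svd(1) IJ cI cJ P(1) Q(1) P(2) Q(2)])
qed

text \<open>The decomposition is quantified for each minimizer separately: with repeated singular
  values, different minimizers may require different singular vectors.\<close>

theorem theorem3p2:
  fixes loss :: "real^'n::{finite,wellorder}^'m::{finite,wellorder} \<Rightarrow> real"
    and grad :: "real^'n::_^'m::_ \<Rightarrow> real^'n::_^'m::_"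
    and W :: "nat \<Rightarrow> real^'n::_^'m::_"
    and L \<eta> :: real
  assumes "L > 0" and "\<eta> > 0"
    and "\<And>X. GDERIV loss X :> grad X"
    and "\<And>X Y. norm (grad X - grad Y) \<le> L * norm (X - Y)"
    and "\<And>t. rank (grad (W t)) \<ge> 2 * CARD('r::{finite,wellorder})"
  shows "\<forall>t. \<forall>(A :: real^'r::_^'m::_) (B :: real^'r::_^'n::_).
    (\<forall>(A' :: real^'r::_^'m::_) (B' :: real^'r::_^'n::_).
       adapter_objective L \<eta> (grad (W t)) A B \<le> adapter_objective L \<eta> (grad (W t)) A' B')
    \<longleftrightarrow>
    (\<exists>U S V I J (P :: real^'r::_^'r::_) (Q :: real^'r::_^'r::_).
       is_svd (grad (W t)) U S V \<and>
       I \<union> J = {1..2 * CARD('r)} \<and> card I = CARD('r) \<and> card J = CARD('r) \<and>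
       orthogonal_matrix P \<and> orthogonal_matrix Q \<and>
       A = (1 / sqrt (L * \<eta>)) *\<^sub>R (cols U I ** P) \<and>
       B = (1 / sqrt (L * \<eta>)) *\<^sub>R (cols V J ** Q))"
proof (intro allI)
  fix t and A :: "real^'r::_^'m::_" and B :: "real^'r::_^'n::_"
  define G where "G = grad (W t)"
  define c where "c = 1 / sqrt (L * \<eta>)"
  have c: "c \<noteq> 0" using assms(1,2) by (simp add: c_def)
  have rank: "2 * CARD('r) \<le> rank G" using assms(5) by (simp add: G_def)
  have dims: "2 * CARD('r) \<le> CARD('m)" "2 * CARD('r) \<le> CARD('n)"
    using rank rank_bound[of G] by auto
  have obj: "adapter_objective L \<eta> G (c *\<^sub>R X) (c *\<^sub>R Y) = 1 / (2 * L) * (norm (residual G X Y))\<^sup>2"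
    for X :: "real^'r::_^'m::_" and Y :: "real^'r::_^'n::_"
    unfolding c_def by (rule adapter_objective_scaled[OF assms(1,2)])
  \<comment> \<open>As \<open>c\<close> is nonzero, every adapter is a scaled one, so minimizing the
    objective amounts to minimizing the norm of \<open>residual\<close>.\<close>
  have unscale: "\<exists>Z. X = c *\<^sub>R Z" for X :: "real^'r::_^'k"
    using c by (intro exI[of _ "(1 / c) *\<^sub>R X"]) simp
  have obj_le: "adapter_objective L \<eta> G (c *\<^sub>R X) (c *\<^sub>R Y) \<le> adapter_objective L \<eta> G (c *\<^sub>R X') (c *\<^sub>R Y')
      \<longleftrightarrow> norm (residual G X Y) \<le> norm (residual G X' Y')"
    for X X' :: "real^'r::_^'m::_" and Y Y' :: "real^'r::_^'n::_"
    unfolding obj using assms(1) by (simp add: divide_le_cancel abs_le_square_iff[symmetric])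
  show "(\<forall>(A' :: real^'r::_^'m::_) (B' :: real^'r::_^'n::_).
      adapter_objective L \<eta> (grad (W t)) A B \<le> adapter_objective L \<eta> (grad (W t)) A' B')
    \<longleftrightarrow>
    (\<exists>U S V I J (P :: real^'r::_^'r::_) (Q :: real^'r::_^'r::_).
       is_svd (grad (W t)) U S V \<and>
       I \<union> J = {1..2 * CARD('r)} \<and> card I = CARD('r) \<and> card J = CARD('r) \<and>
       orthogonal_matrix P \<and> orthogonal_matrix Q \<and>
       A = (1 / sqrt (L * \<eta>)) *\<^sub>R (cols U I ** P) \<and>
       B = (1 / sqrt (L * \<eta>)) *\<^sub>R (cols V J ** Q))"
    unfolding G_def[symmetric] c_def[symmetric]
  proof
    assume min: "\<forall>(A' :: real^'r::_^'m::_) (B' :: real^'r::_^'n::_).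
      adapter_objective L \<eta> G A B \<le> adapter_objective L \<eta> G A' B'"
    obtain A0 where A0: "A = c *\<^sub>R A0" using unscale by blast
    obtain B0 where B0: "B = c *\<^sub>R B0" using unscale by blast
    have "norm (residual G A0 B0) \<le> norm (residual G A' B')" for A' :: "real^'r::_^'m::_" and B' :: "real^'r::_^'n::_"
      unfolding obj_le[symmetric] A0[symmetric] B0[symmetric] using min by blast
    then obtain U S V I J and P Q :: "real^'r::_^'r::_" where res: "is_svd G U S V" "I \<union> J = {1..2 * CARD('r)}"
      "card I = CARD('r)" "card J = CARD('r)" "orthogonal_matrix P" "orthogonal_matrix Q"
      "A0 = cols U I ** P" "B0 = cols V J ** Q"
      by (rule adapter_characterization[OF rank])
    show "\<exists>U S V I J (P :: real^'r::_^'r::_) (Q :: real^'r::_^'r::_).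
       is_svd G U S V \<and>
       I \<union> J = {1..2 * CARD('r)} \<and> card I = CARD('r) \<and> card J = CARD('r) \<and>
       orthogonal_matrix P \<and> orthogonal_matrix Q \<and>
       A = c *\<^sub>R (cols U I ** P) \<and> B = c *\<^sub>R (cols V J ** Q)"
      unfolding A0 B0 res(7,8)
      by (rule exI[of _ U], rule exI[of _ S], rule exI[of _ V], rule exI[of _ I], rule exI[of _ J],
          rule exI[of _ P], rule exI[of _ Q]) (intro conjI res(1-6) refl)
  next
    assume "\<exists>U S V I J (P :: real^'r::_^'r::_) (Q :: real^'r::_^'r::_).
       is_svd G U S V \<and>
       I \<union> J = {1..2 * CARD('r)} \<and> card I = CARD('r) \<and> card J = CARD('r) \<and>
       orthogonal_matrix P \<and> orthogonal_matrix Q \<and>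
       A = c *\<^sub>R (cols U I ** P) \<and> B = c *\<^sub>R (cols V J ** Q)"
    then obtain U S V I J and P Q :: "real^'r::_^'r::_" where res: "is_svd G U S V" "I \<union> J = {1..2 * CARD('r)}"
      "card I = CARD('r)" "card J = CARD('r)" "orthogonal_matrix P" "orthogonal_matrix Q"
      and AB: "A = c *\<^sub>R (cols U I ** P)" "B = c *\<^sub>R (cols V J ** Q)"
      by (elim exE conjE)
    show "\<forall>(A' :: real^'r::_^'m::_) (B' :: real^'r::_^'n::_).
      adapter_objective L \<eta> G A B \<le> adapter_objective L \<eta> G A' B'"
    proof (intro allI)
      fix A' :: "real^'r::_^'m::_" and B' :: "real^'r::_^'n::_"
      obtain A1 where A1: "A' = c *\<^sub>R A1" using unscale by blast
      obtain B1 where B1: "B' = c *\<^sub>R B1" using unscale by blast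
      \<comment> \<open>The value computed by \<open>residual_svd\<close> is the lower bound for all
        pairs, with \<open>K\<close> the top energy of the same decomposition.\<close>
      have "(norm (residual G (cols U I ** P) (cols V J ** Q)))\<^sup>2 \<le> (norm (residual G A1 B1))\<^sup>2"
        unfolding residual_svd[OF res(1) dims res(2-6)]
        by (rule residual_lower_bound[OF dims(2) svd_ky_fan[OF res(1) dims(2)]])
      then have "norm (residual G (cols U I ** P) (cols V J ** Q)) \<le> norm (residual G A1 B1)"
        by (rule power2_le_imp_le) simp
      then show "adapter_objective L \<eta> G A B \<le> adapter_objective L \<eta> G A' B'"
        unfolding AB A1 B1 by (simp only: obj_le)
    qed
  qed
qed

end
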